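(* Let $(\mathcal{A},\varphi)$ be a non-commutative probability space, $\theta$ a state on $\mathcal{A}$, and $\big((\mathcal{A}_\ell^{(\iota)},\mathcal{A}_r^{(\iota)})\big)_{\iota\in\mathcal{I}}$ a family of pairs of faces in $\mathcal{A}$. Then the family is conditionally bi-free with respect to $(\theta,\varphi)$ if and only if the following holds: whenever $n\ge1$, $\chi:\{1,\dots,n\}\to\{\ell,r\}$, $\epsilon:\{1,\dots,n\}\to\mathcal{I}$, $\mathcal{J}$ is the set of maximal $\epsilon$-monochromatic $\chi$-intervals, and $z_1,\dots,z_n\in\mathcal{A}$ satisfy $z_i\in\mathcal{A}^{(\epsilon(i))}_{\chi(i)}$ and $\varphi(z_J)=0$ for every $J\in\mathcal{J}$, then $$\varphi(z_1\cdots z_n)=0\qquad\text{and}\qquad \theta(z_1\cdots z_n)=\prod_{J\in\mathcal{J}}\theta(z_J).$$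
   Context: A non-commutative probability space is a pair $(\mathcal{A},\varphi)$ with $\mathcal{A}$ a unital $*$-algebra and $\varphi$ a state; a pair of faces is a pair of unital subalgebras $(\mathcal{A}_\ell,\mathcal{A}_r)$. Notation: for $\chi:\{1,\dots,n\}\to\{\ell,r\}$ write $\chi^{-1}(\ell)=\{i_1<\dots<i_p\}$, $\chi^{-1}(r)=\{i_{p+1}>\dots>i_n\}$, $s_\chi(k)=i_k$, and $i\prec_\chi j$ iff $s_\chi^{-1}(i)<s_\chi^{-1}(j)$. A $\chi$-interval is an interval for $\prec_\chi$. A set is $\epsilon$-monochromatic if $\epsilon$ is constant on it. For $B=\{b_1<\dots<b_k\}$, $z_B:=z_{b_1}\cdots z_{b_k}$. $BNC(\chi)$ is the set of partitions $\pi$ of $\{1,\dots,n\}$ such that $s_\chi^{-1}\cdot\pi$ is a non-crossing partition. The bi-free cumulants $\kappa_\chi:\mathcal{A}^n\to\mathbb{C}$ (with respect to $\varphi$) are the multilinear functionals determined by $\varphi(z_1\cdots z_n)=\sum_{\pi\in BNC(\chi)}\prod_{B\in\pi}\kappa_{\chi|_B}((z_1,\dots,z_n)|_B)$. For $\pi\in BNC(\chi)$, a block $B\in\pi$ is inner if there is another block $C\in\pi$ and $j,k\in C$ with $j\prec_\chi i\prec_\chi k$ for every $i\in B$; otherwise $B$ is outer. The conditional cumulants $\mathcal{K}_\chi:\mathcal{A}^n\to\mathbb{C}$ with respect to $(\theta,\varphi)$ are the multilinear functionals determined by $$\theta(z_1\cdots z_n)=\sum_{\pi\in BNC(\chi)}\Big(\prod_{V\in\pi,\,V\text{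 inner}}\kappa_{\chi|_V}((z_1,\dots,z_n)|_V)\Big)\Big(\prod_{V\in\pi,\,V\text{ outer}}\mathcal{K}_{\chi|_V}((z_1,\dots,z_n)|_V)\Big).$$ The family is conditionally bi-free with respect to $(\theta,\varphi)$ if it is bi-free with respect to $\varphi$ (i.e. all mixed bi-free cumulants $\kappa_\chi(z_1,\dots,z_n)$ with $z_i\in\mathcal{A}^{(\epsilon(i))}_{\chi(i)}$, $\epsilon$ non-constant, vanish) and all mixed conditional cumulants $\mathcal{K}_\chi(z_1,\dots,z_n)$ with $z_i\in\mathcal{A}^{(\epsilon(i))}_{\chi(i)}$, $\epsilon$ non-constant, vanish. *)

theory Defs
  imports Complex_Main "HOL-Library.Disjoint_Sets"
begin

definition star_algebra :: "(complex \<Rightarrow> 'a::ring_1 \<Rightarrow> 'a) \<Rightarrow> ('a \<Rightarrow> 'a) \<Rightarrow> bool" where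
  "star_algebra sc st \<longleftrightarrow>
     vector_space sc \<and>
     (\<forall>c x y. sc c (x * y) = sc c x * y \<and> sc c (x * y) = x * sc c y) \<and>
     (\<forall>x. st (st x) = x) \<and>
     (\<forall>x y. st (x + y) = st x + st y) \<and>
     (\<forall>c x. st (sc c x) = sc (cnj c) (st x)) \<and>
     (\<forall>x y. st (x * y) = st y * st x)"

definition is_state :: "(complex \<Rightarrow> 'a::ring_1 \<Rightarrow> 'a) \<Rightarrow> ('a \<Rightarrow> 'a) \<Rightarrow> ('a \<Rightarrow> complex) \<Rightarrow> bool" where
  "is_state sc st \<phi> \<longleftrightarrow>
     (\<forall>x y. \<phi> (x + y) = \<phi> x + \<phi> y) \<and>
     (\<forall>c x. \<phi> (sc c x) = c * \<phi> x) \<and>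
     \<phi> 1 = 1 \<and>
     (\<forall>x. Im (\<phi> (st x * x)) = 0 \<and> Re (\<phi> (st x * x)) \<ge> 0)"

definition unital_subalgebra :: "(complex \<Rightarrow> 'a::ring_1 \<Rightarrow> 'a) \<Rightarrow> 'a set \<Rightarrow> bool" where
  "unital_subalgebra sc S \<longleftrightarrow>
     1 \<in> S \<and> (\<forall>x\<in>S. \<forall>y\<in>S. x + y \<in> S \<and> x * y \<in> S) \<and> (\<forall>c. \<forall>x\<in>S. sc c x \<in> S)"

datatype face = Lf | Rf

section \<open>Bi-non-crossing partitions (positions are 0-based: 0..<n)\<close>

text \<open>ord_chi chi i is s_chi^{-1}(i) (0-based): left positions in increasing order,
  followed by right positions in decreasing order.\<close>
definition ord_chi :: "face list \<Rightarrow> nat \<Rightarrow> nat" where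
  "ord_chi \<chi> i =
     (if \<chi> ! i = Lf then card {j. j < i \<and> \<chi> ! j = Lf}
      else card {j. j < length \<chi> \<and> \<chi> ! j = Lf} + card {j. i < j \<and> j < length \<chi> \<and> \<chi> ! j = Rf})"

definition prec_chi :: "face list \<Rightarrow> nat \<Rightarrow> nat \<Rightarrow> bool" where
  "prec_chi \<chi> i j \<longleftrightarrow> ord_chi \<chi> i < ord_chi \<chi> j"

text \<open>pi is in BNC(chi) iff s_chi^{-1} . pi is non-crossing.\<close>
definition BNC :: "face list \<Rightarrow> nat set set set" where
  "BNC \<chi> = {\<pi>. partition_on {0..<length \<chi>} \<pi> \<and>
     \<not> (\<exists>B\<in>\<pi>. \<exists>C\<in>\<pi>. B \<noteq> C \<and> (\<exists>a b c d. a \<in> B \<and> c \<in> B \<and> b \<in> C \<and> d \<in> C \<and>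
            prec_chi \<chi> a b \<and> prec_chi \<chi> b c \<and> prec_chi \<chi> c d))}"

definition inner_block :: "face list \<Rightarrow> nat set set \<Rightarrow> nat set \<Rightarrow> bool" where
  "inner_block \<chi> \<pi> V \<longleftrightarrow>
     (\<exists>C\<in>\<pi>. C \<noteq> V \<and> (\<exists>j\<in>C. \<exists>k\<in>C. \<forall>i\<in>V. prec_chi \<chi> j i \<and> prec_chi \<chi> i k))"

text \<open>Cumulant families are functions of (chi, (z_1,...,z_n)); off their domain
  (length mismatch or n = 0) they are normalised to 0, which makes them unique.\<close>

definition bf_cumulant_eqs :: "('a::ring_1 \<Rightarrow> complex) \<Rightarrow> (face list \<Rightarrow> 'a list \<Rightarrow> complex) \<Rightarrow> bool" where
  "bf_cumulant_eqs \<phi> \<kappa> \<longleftrightarrow>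
     (\<forall>\<chi> zs. length zs = length \<chi> \<and> \<chi> \<noteq> [] \<longrightarrow>
        \<phi> (prod_list zs) = (\<Sum>\<pi>\<in>BNC \<chi>. \<Prod>B\<in>\<pi>. \<kappa> (nths \<chi> B) (nths zs B))) \<and>
     (\<forall>\<chi> zs. length zs \<noteq> length \<chi> \<or> \<chi> = [] \<longrightarrow> \<kappa> \<chi> zs = 0)"

definition bf_cumulants :: "('a::ring_1 \<Rightarrow> complex) \<Rightarrow> face list \<Rightarrow> 'a list \<Rightarrow> complex" where
  "bf_cumulants \<phi> = (THE \<kappa>. bf_cumulant_eqs \<phi> \<kappa>)"

definition cond_cumulant_eqs :: "('a::ring_1 \<Rightarrow> complex) \<Rightarrow> ('a \<Rightarrow> complex)
     \<Rightarrow> (face list \<Rightarrow> 'a list \<Rightarrow> complex) \<Rightarrow> bool" where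
  "cond_cumulant_eqs \<theta> \<phi> K \<longleftrightarrow>
     (\<forall>\<chi> zs. length zs = length \<chi> \<and> \<chi> \<noteq> [] \<longrightarrow>
        \<theta> (prod_list zs) =
          (\<Sum>\<pi>\<in>BNC \<chi>.
             (\<Prod>V\<in>{V\<in>\<pi>. inner_block \<chi> \<pi> V}. bf_cumulants \<phi> (nths \<chi> V) (nths zs V)) *
             (\<Prod>V\<in>{V\<in>\<pi>. \<not> inner_block \<chi> \<pi> V}. K (nths \<chi> V) (nths zs V)))) \<and>
     (\<forall>\<chi> zs. length zs \<noteq> length \<chi> \<or> \<chi> = [] \<longrightarrow> K \<chi> zs = 0)"

definition cond_cumulants :: "('a::ring_1 \<Rightarrow> complex) \<Rightarrow> ('a \<Rightarrow> complex) \<Rightarrow> face list \<Rightarrow> 'a list \<Rightarrow> complex" where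
  "cond_cumulants \<theta> \<phi> = (THE K. cond_cumulant_eqs \<theta> \<phi> K)"

definition mixed_vanish :: "(face list \<Rightarrow> 'a list \<Rightarrow> complex) \<Rightarrow> ('i \<Rightarrow> face \<Rightarrow> 'a set) \<Rightarrow> bool" where
  "mixed_vanish \<kappa> A \<longleftrightarrow>
     (\<forall>\<chi> (\<epsilon>::nat \<Rightarrow> 'i) zs. length zs = length \<chi> \<and> \<chi> \<noteq> [] \<and>
        (\<forall>i<length \<chi>. zs ! i \<in> A (\<epsilon> i) (\<chi> ! i)) \<and>
        (\<exists>i<length \<chi>. \<exists>j<length \<chi>. \<epsilon> i \<noteq> \<epsilon> j) \<longrightarrow> \<kappa> \<chi> zs = 0)"

definition bi_free :: "('a::ring_1 \<Rightarrow> complex) \<Rightarrow> ('i \<Rightarrow> face \<Rightarrow> 'a set) \<Rightarrow> bool" where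
  "bi_free \<phi> A \<longleftrightarrow> mixed_vanish (bf_cumulants \<phi>) A"

definition cond_bi_free :: "('a::ring_1 \<Rightarrow> complex) \<Rightarrow> ('a \<Rightarrow> complex) \<Rightarrow> ('i \<Rightarrow> face \<Rightarrow> 'a set) \<Rightarrow> bool" where
  "cond_bi_free \<theta> \<phi> A \<longleftrightarrow> bi_free \<phi> A \<and> mixed_vanish (cond_cumulants \<theta> \<phi>) A"

definition chi_interval :: "face list \<Rightarrow> nat set \<Rightarrow> bool" where
  "chi_interval \<chi> J \<longleftrightarrow> J \<noteq> {} \<and> J \<subseteq> {0..<length \<chi>} \<and>
     (\<forall>i\<in>J. \<forall>k\<in>J. \<forall>j<length \<chi>. prec_chi \<chi> i j \<and> prec_chi \<chi> j k \<longrightarrow> j \<in> J)"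

definition monochromatic :: "(nat \<Rightarrow> 'i) \<Rightarrow> nat set \<Rightarrow> bool" where
  "monochromatic \<epsilon> J \<longleftrightarrow> (\<forall>i\<in>J. \<forall>j\<in>J. \<epsilon> i = \<epsilon> j)"

definition max_mono_intervals :: "face list \<Rightarrow> (nat \<Rightarrow> 'i) \<Rightarrow> nat set set" where
  "max_mono_intervals \<chi> \<epsilon> =
     {J. chi_interval \<chi> J \<and> monochromatic \<epsilon> J \<and>
         \<not> (\<exists>J'. J \<subset> J' \<and> chi_interval \<chi> J' \<and> monochromatic \<epsilon> J')}"

end

theory Submission
  imports Defs
begin


text \<open>
  Write a moment as a sum over non-crossing partitions, with inner blocks weighted by \<open>\<kappa>\<close> and
  outer blocks by \<open>K\<close>. Splitting off the least point \<open>m\<close> and the next point \<open>w\<close> of its block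
  gives a recursion; from it, if weights of mixed blocks vanish and every maximal monochromatic
  interval except possibly the first and the last is \<open>\<phi>\<close>-centred, the sum factors over these
  intervals: whenever the block of \<open>m\<close> leaves its interval, the gap jumped over contains a whole
  centred interval and contributes \<open>0\<close>. That is the forward implication.

  Conversely, replace the weights of all mixed blocks by \<open>0\<close> and compare the resulting sum with the
  true moment. Under \<open>z\<^sub>i \<mapsto> z\<^sub>i + t\<close> both change by \<open>t\<close> times the same expression with \<open>z\<^sub>i\<close>
  deleted, as cumulants of length at least two are invariant, so by induction on the length the
  difference is invariant under such shifts. Shifts can centre all maximal monochromatic intervals
  at once, and then the factorisations agree. Hence the mixed cumulants vanish, by uniqueness.
\<close>

section \<open>Weighted sums over non-crossing partitions\<close>

text \<open>The combinatorics is carried out on finite sets ordered by a key rather than on lists: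
  gaps, tails and words with a letter deleted are then subsets of one set, with no renumbering of
  positions. Two weights are kept apart because the recursion treats them differently. Everything in
  the gap between \<open>m\<close> and \<open>w\<close> is enclosed by the block of
  \<open>m\<close>, so the gap is summed with \<open>k\<close> in both roles; on the far side only
  the outer weight changes, as the block of \<open>w\<close> has to remember \<open>m\<close>. The
  first and last intervals are exempt from centring because the recursion cuts into them: it removes
  points from the first one, and a gap stops inside the interval of \<open>w\<close>. In the
  converse direction a mixed cumulant cannot be isolated by centring single letters, since the
  hypothesis concerns products over whole intervals; this is why whole moments are compared, with
  scalar shifts as the available freedom. The condition on \<open>\<phi>\<close> is the
  factorisation property with \<open>\<theta>\<close> replaced by \<open>\<phi>\<close>, all factors
  being zero, so bi-freeness and the conditional half are two instances of one argument.\<close>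

definition noncrossing :: "('x \<Rightarrow> 'k::linorder) \<Rightarrow> 'x set set \<Rightarrow> bool" where
  "noncrossing key \<pi> \<longleftrightarrow>
     \<not> (\<exists>B\<in>\<pi>. \<exists>C\<in>\<pi>. B \<noteq> C \<and> (\<exists>a b c d. a \<in> B \<and> c \<in> B \<and> b \<in> C \<and> d \<in> C \<and>
            key a < key b \<and> key b < key c \<and> key c < key d))"

definition nc :: "('x \<Rightarrow> 'k::linorder) \<Rightarrow> 'x set \<Rightarrow> 'x set set set" where
  "nc key X = {\<pi>. partition_on X \<pi> \<and> noncrossing key \<pi>}"

definition inner :: "('x \<Rightarrow> 'k::linorder) \<Rightarrow> 'x set set \<Rightarrow> 'x set \<Rightarrow> bool" where
  "inner key \<pi> V \<longleftrightarrow>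
     (\<exists>C\<in>\<pi>. C \<noteq> V \<and> (\<exists>j\<in>C. \<exists>k\<in>C. \<forall>i\<in>V. key j < key i \<and> key i < key k))"

definition weight :: "('x \<Rightarrow> 'k::linorder) \<Rightarrow> ('x set \<Rightarrow> complex) \<Rightarrow> ('x set \<Rightarrow> complex) \<Rightarrow> 'x set set \<Rightarrow> complex" where
  "weight key k K \<pi> = (\<Prod>V\<in>\<pi>. if inner key \<pi> V then k V else K V)"

text \<open>For \<open>K = k\<close> the inner-outer distinction disappears and this is the bi-free
  moment-cumulant sum; the recursion below leads to this case inside gaps even when the outer weight
  is different.\<close>

definition Mom :: "('x \<Rightarrow> 'k::linorder) \<Rightarrow> ('x set \<Rightarrow> complex) \<Rightarrow> ('x set \<Rightarrow> complex) \<Rightarrow> 'x set \<Rightarrow> complex" where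
  "Mom key k K X = (\<Sum>\<pi>\<in>nc key X. weight key k K \<pi>)"

lemma noncrossingD:
  assumes "noncrossing key \<pi>" "B \<in> \<pi>" "C \<in> \<pi>" "a \<in> B" "c \<in> B" "b \<in> C" "d \<in> C"
    and "key a < key b" "key b < key c" "key c < key d"
  shows "B = C"
  using assms(1)[unfolded noncrossing_def not_ex bex_simps, rule_format, OF assms(2,3)] assms(4-) by metis

lemma noncrossingI:
  assumes "\<And>B C a b c d. \<lbrakk>B \<in> \<pi>; C \<in> \<pi>; a \<in> B; c \<in> B; b \<in> C; d \<in> C;
    key a < key b; key b < key c; key c < key d\<rbrakk> \<Longrightarrow> B = C"
  shows "noncrossing key \<pi>"
  unfolding noncrossing_def
proof (rule notI, elim bexE conjE exE)
  fix B C a b c d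
  assume "B \<in> \<pi>" "C \<in> \<pi>" "B \<noteq> C" "a \<in> B" "c \<in> B" "b \<in> C" "d \<in> C"
    "key a < key b" "key b < key c" "key c < key d"
  then show False using assms[of B C a c b d] by simp
qed

lemma innerI:
  assumes "C \<in> \<pi>" "C \<noteq> V" "j \<in> C" "k \<in> C"
    and "\<And>i. i \<in> V \<Longrightarrow> key j < key i" "\<And>i. i \<in> V \<Longrightarrow> key i < key k"
  shows "inner key \<pi> V"
  unfolding inner_def using assms by (intro bexI[of _ C] bexI[of _ j] bexI[of _ k] conjI ballI) auto

lemma innerE:
  assumes "inner key \<pi> V"
  obtains C j k where "C \<in> \<pi>" "C \<noteq> V" "j \<in> C" "k \<in> C"
    and "\<And>i. i \<in> V \<Longrightarrow> key j < key i" "\<And>i. i \<in> V \<Longrightarrow> key i < key k"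
proof -
  from assms obtain C j k where "C \<in> \<pi>" "C \<noteq> V" "j \<in> C" "k \<in> C" "\<forall>i\<in>V. key j < key i \<and> key i < key k"
    unfolding inner_def by (elim bexE conjE)
  then show thesis using that by simp
qed

lemma noncrossing_subset:
  assumes "noncrossing key \<pi>" "\<rho> \<subseteq> \<pi>" shows "noncrossing key \<rho>"
proof (rule noncrossingI)
  fix B C a b c d
  assume "B \<in> \<rho>" "C \<in> \<rho>" and h: "a \<in> B" "c \<in> B" "b \<in> C" "d \<in> C"
    "key a < key b" "key b < key c" "key c < key d"
  then show "B = C" using noncrossingD[OF assms(1) _ _ h] assms(2) by blast
qed

lemma finite_nc: "finite X \<Longrightarrow> finite (nc key X)"
  unfolding nc_def by (rule finite_subset[OF _ finitely_many_partition_on]) auto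

lemma nc_finite:
  assumes "finite X" "\<pi> \<in> nc key X" shows "finite \<pi>"
  using assms finite_elements unfolding nc_def by blast

lemma nc_subset:
  assumes "\<pi> \<in> nc key X" "B \<in> \<pi>" shows "B \<subseteq> X" "B \<noteq> {}"
  using assms unfolding nc_def partition_on_def by auto

lemma nc_block_eq:
  assumes "\<pi> \<in> nc key X" "B \<in> \<pi>" "C \<in> \<pi>" "x \<in> B" "x \<in> C" shows "B = C"
  using assms unfolding nc_def partition_on_def disjoint_def by blast

lemma nc_blockE:
  assumes "\<pi> \<in> nc key X" "x \<in> X" obtains B where "B \<in> \<pi>" "x \<in> B"
  using assms unfolding nc_def partition_on_def by blast

lemma ncI:
  assumes "\<Union>\<pi> = X" "\<And>B. B \<in> \<pi> \<Longrightarrow> B \<noteq> {}"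
    and "\<And>B C x. \<lbrakk>B \<in> \<pi>; C \<in> \<pi>; x \<in> B; x \<in> C\<rbrakk> \<Longrightarrow> B = C"
    and "noncrossing key \<pi>"
  shows "\<pi> \<in> nc key X"
  using assms unfolding nc_def partition_on_def disjoint_def by blast

lemma Mom_empty [simp]: "Mom key k K {} = 1"
proof -
  have "nc key {} = {{}}" by (auto simp: nc_def partition_on_def noncrossing_def)
  then show ?thesis by (simp add: Mom_def weight_def)
qed

lemma Mom_cong:
  assumes "\<And>B. B \<subseteq> X \<Longrightarrow> B \<noteq> {} \<Longrightarrow> k B = k' B" "\<And>B. B \<subseteq> X \<Longrightarrow> B \<noteq> {} \<Longrightarrow> K B = K' B"
  shows "Mom key k K X = Mom key k' K' X"
  unfolding Mom_def weight_def
  by (intro sum.cong prod.cong refl) (simp add: assms nc_subset)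

lemma nc_image:
  assumes inj: "inj_on h X"
    and ord: "\<And>x y. x \<in> X \<Longrightarrow> y \<in> X \<Longrightarrow> key' (h x) < key' (h y) \<longleftrightarrow> key x < key y"
    and p: "\<pi> \<in> nc key X"
  shows "(`) h ` \<pi> \<in> nc key' (h ` X)"
proof (rule ncI)
  show "\<Union> ((`) h ` \<pi>) = h ` X" using p unfolding nc_def partition_on_def by auto
  show "B \<noteq> {}" if "B \<in> (`) h ` \<pi>" for B using that nc_subset(2)[OF p] by auto
  show "B = C" if BC: "B \<in> (`) h ` \<pi>" "C \<in> (`) h ` \<pi>" "x \<in> B" "x \<in> C" for B C x
  proof -
    from BC obtain B' C' b c where *: "B' \<in> \<pi>" "C' \<in> \<pi>" "b \<in> B'" "c \<in> C'" "h b = x" "h c = x" "B = h ` B'" "C = h ` C'"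
      by auto
    then have "b = c" using inj nc_subset[OF p] by (metis inj_on_def subsetD)
    then show ?thesis using * nc_block_eq[OF p] by metis
  qed
  have ord': "\<And>x y B C. B \<in> \<pi> \<Longrightarrow> C \<in> \<pi> \<Longrightarrow> x \<in> B \<Longrightarrow> y \<in> C \<Longrightarrow> key' (h x) < key' (h y) \<longleftrightarrow> key x < key y"
    using ord nc_subset(1)[OF p] by blast
  have ncr: "noncrossing key \<pi>" using p by (simp add: nc_def)
  show "noncrossing key' ((`) h ` \<pi>)"
  proof (rule noncrossingI)
    fix B C a b c d
    assume "B \<in> (`) h ` \<pi>" "C \<in> (`) h ` \<pi>" "a \<in> B" "c \<in> B" "b \<in> C" "d \<in> C"
      and lt: "key' a < key' b" "key' b < key' c" "key' c < key' d"
    then obtain B' C' a' b' c' d' where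
      *: "B = h ` B'" "C = h ` C'" "B' \<in> \<pi>" "C' \<in> \<pi>" "a' \<in> B'" "c' \<in> B'" "b' \<in> C'" "d' \<in> C'"
         "a = h a'" "b = h b'" "c = h c'" "d = h d'" by auto
    have "B' = C'"
      by (rule noncrossingD[OF ncr *(3-8)]) (use lt * ord' in metis)+
    then show "B = C" using * by simp
  qed
qed

lemma inner_image:
  assumes inj: "inj_on h X"
    and ord: "\<And>x y. x \<in> X \<Longrightarrow> y \<in> X \<Longrightarrow> key' (h x) < key' (h y) \<longleftrightarrow> key x < key y"
    and p: "\<pi> \<in> nc key X" and V: "V \<in> \<pi>"
  shows "inner key' ((`) h ` \<pi>) (h ` V) \<longleftrightarrow> inner key \<pi> V"
proof -
  have ne: "h ` C \<noteq> h ` V \<longleftrightarrow> C \<noteq> V" if "C \<in> \<pi>" for C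
    using inj_on_image_eq_iff[OF inj] nc_subset(1)[OF p] that V by blast
  have "(\<exists>j\<in>h ` C. \<exists>k\<in>h ` C. \<forall>i\<in>h ` V. key' j < key' i \<and> key' i < key' k) \<longleftrightarrow>
        (\<exists>j\<in>C. \<exists>k\<in>C. \<forall>i\<in>V. key j < key i \<and> key i < key k)" if "C \<in> \<pi>" for C
  proof -
    have *: "C \<subseteq> X" "V \<subseteq> X" using nc_subset(1)[OF p] that V by auto
    then have "(\<forall>i\<in>V. key' (h j) < key' (h i) \<and> key' (h i) < key' (h k)) \<longleftrightarrow>
       (\<forall>i\<in>V. key j < key i \<and> key i < key k)" if "j \<in> C" "k \<in> C" for j k
      using that ord by blast
    then show ?thesis by auto
  qed
  then show ?thesis unfolding inner_def using ne by auto
qed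

text \<open>Only the relative order of the keys enters a weight, so an order-preserving injection
  transports the whole sum. This is the bridge from positions in a list, ordered by
  \<open>ord_chi\<close>, to a finite set of positions ordered by \<open>key_chi\<close>.\<close>

lemma Mom_image:
  assumes inj: "inj_on h X"
    and ord: "\<And>x y. x \<in> X \<Longrightarrow> y \<in> X \<Longrightarrow> key' (h x) < key' (h y) \<longleftrightarrow> key x < key y"
  shows "Mom key' k K (h ` X) = Mom key (\<lambda>B. k (h ` B)) (\<lambda>B. K (h ` B)) X"
proof -
  define g where "g = the_inv_into X h"
  have gh: "g (h x) = x" if "x \<in> X" for x using inj that by (simp add: g_def the_inv_into_f_f)
  have g_inj: "inj_on g (h ` X)" using gh by (auto intro!: inj_onI)
  have gX: "g ` h ` X = X" using gh by force
  have g_ord: "key (g x) < key (g y) \<longleftrightarrow> key' x < key' y" if "x \<in> h ` X" "y \<in> h ` X" for x y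
    using that ord gh by auto
  have gh_set: "g ` h ` B = B" if "B \<subseteq> X" for B using gh that by (force simp: image_iff)
  have hg_set: "h ` g ` B = B" if "B \<subseteq> h ` X" for B
  proof -
    have "h (g b) = b" if "b \<in> B" for b using that \<open>B \<subseteq> h ` X\<close> gh by force
    then show ?thesis by (force simp: image_iff)
  qed
  have gh_p: "(`) g ` (`) h ` \<pi> = \<pi>" if "\<pi> \<in> nc key X" for \<pi>
    using gh_set nc_subset(1)[OF that] by (force simp: image_iff)
  have hg_p: "(`) h ` (`) g ` \<pi> = \<pi>" if "\<pi> \<in> nc key' (h ` X)" for \<pi>
    using hg_set nc_subset(1)[OF that] by (force simp: image_iff)
  have "(\<Sum>\<pi>\<in>nc key X. weight key (\<lambda>B. k (h ` B)) (\<lambda>B. K (h ` B)) \<pi>) = (\<Sum>\<pi>\<in>nc key' (h ` X). weight key' k K \<pi>)"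
  proof (rule sum.reindex_bij_witness[where i="\<lambda>\<pi>. (`) g ` \<pi>" and j="\<lambda>\<pi>. (`) h ` \<pi>"])
    fix \<pi> assume p: "\<pi> \<in> nc key X"
    show "(`) g ` (`) h ` \<pi> = \<pi>" using gh_p[OF p] .
    show "(`) h ` \<pi> \<in> nc key' (h ` X)" by (rule nc_image[OF inj ord p])
    have "inj_on ((`) h) \<pi>"
      by (rule inj_onI) (use inj_on_image_eq_iff[OF inj] nc_subset(1)[OF p] in metis)
    then show "weight key' k K ((`) h ` \<pi>) = weight key (\<lambda>B. k (h ` B)) (\<lambda>B. K (h ` B)) \<pi>"
      unfolding weight_def by (simp add: prod.reindex inner_image[where key'=key', OF inj ord p] cong: prod.cong)
  next
    fix \<pi> assume p: "\<pi> \<in> nc key' (h ` X)"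
    show "(`) h ` (`) g ` \<pi> = \<pi>" using hg_p[OF p] .
    show "(`) g ` \<pi> \<in> nc key X" using nc_image[OF g_inj g_ord p] by (simp add: gX)
  qed
  then show ?thesis by (simp add: Mom_def)
qed

text \<open>The partition \<open>{X}\<close> is the only one with \<open>X\<close> as a block, and
  there \<open>X\<close> is outer. Hence \<open>K X\<close> enters the sum exactly once, with
  coefficient one, and the remainder sees only proper subsets. This triangularity is what lets equal
  moments force equal cumulants.\<close>

lemma Mom_top:
  assumes X: "finite X" "X \<noteq> {}"
    and k: "\<And>B. B \<subset> X \<Longrightarrow> B \<noteq> {} \<Longrightarrow> k B = k' B" and K: "\<And>B. B \<subset> X \<Longrightarrow> B \<noteq> {} \<Longrightarrow> K B = K' B"
  shows "Mom key k K X - K X = Mom key k' K' X - K' X"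
proof -
  have top: "{X} \<in> nc key X" using X by (auto intro!: ncI noncrossingI)
  have w: "weight key k K {X} = K X" for k K :: "_ \<Rightarrow> complex"
    by (simp add: weight_def inner_def)
  have eq: "Mom key k K X - K X = (\<Sum>\<pi>\<in>nc key X - {{X}}. weight key k K \<pi>)" for k K :: "_ \<Rightarrow> complex"
    unfolding Mom_def by (subst sum.remove[OF finite_nc[OF X(1)] top]) (simp add: w)
  have "weight key k K \<pi> = weight key k' K' \<pi>" if p: "\<pi> \<in> nc key X - {{X}}" for \<pi>
  proof -
    have "B \<subset> X \<and> B \<noteq> {}" if "B \<in> \<pi>" for B
    proof -
      have "B \<noteq> X"
      proof
        assume "B = X"
        then have "C = X" if "C \<in> \<pi>" for C
          using nc_subset[of \<pi> key X C] nc_block_eq[of \<pi> key X B C] that \<open>B \<in> \<pi>\<close> p by blast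
        then show False using p \<open>B \<in> \<pi>\<close> \<open>B = X\<close> by blast
      qed
      then show ?thesis using nc_subset[of \<pi> key X B] that p by blast
    qed
    then show ?thesis unfolding weight_def by (intro prod.cong refl) (simp add: k K)
  qed
  then show ?thesis unfolding eq by (rule sum.cong[OF refl])
qed

section \<open>Splitting off a singleton block\<close>

lemma nc_insert_singleton:
  assumes "i \<in> X" "\<rho> \<in> nc key (X - {i})"
  shows "insert {i} \<rho> \<in> nc key X"
proof (rule ncI)
  show "\<Union> (insert {i} \<rho>) = X" using assms unfolding nc_def partition_on_def by auto
  show "B \<noteq> {}" if "B \<in> insert {i} \<rho>" for B using that nc_subset(2)[OF assms(2)] by auto
  show "B = C" if "B \<in> insert {i} \<rho>" "C \<in> insert {i} \<rho>" "x \<in> B" "x \<in> C" for B C x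
    using that nc_subset(1)[OF assms(2)] nc_block_eq[OF assms(2)] by blast
  have "noncrossing key \<rho>" using assms by (simp add: nc_def)
  show "noncrossing key (insert {i} \<rho>)"
  proof (rule noncrossingI)
    fix B C a b c d
    assume h: "B \<in> insert {i} \<rho>" "C \<in> insert {i} \<rho>" "a \<in> B" "c \<in> B" "b \<in> C" "d \<in> C"
      and lt: "key a < key b" "key b < key c" "key c < key d"
    have "a \<noteq> c" "b \<noteq> d" using lt by (metis less_asym less_trans)+
    then have "B \<noteq> {i}" "C \<noteq> {i}" using h by auto
    then show "B = C" using noncrossingD[OF \<open>noncrossing key \<rho>\<close> _ _ h(3-6) lt] h(1,2) by simp
  qed
qed

lemma nc_remove_singleton:
  assumes "{i} \<in> \<pi>" "\<pi> \<in> nc key X"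
  shows "\<pi> - {{i}} \<in> nc key (X - {i})"
proof (rule ncI)
  show "\<Union> (\<pi> - {{i}}) = X - {i}"
    using assms nc_block_eq[OF assms(2) assms(1)] unfolding nc_def partition_on_def by blast
  have "noncrossing key \<pi>" using assms by (simp add: nc_def)
  then show "noncrossing key (\<pi> - {{i}})" by (rule noncrossing_subset) simp
  show "B \<noteq> {}" if "B \<in> \<pi> - {{i}}" for B using that nc_subset(2)[OF assms(2)] by simp
  show "B = C" if "B \<in> \<pi> - {{i}}" "C \<in> \<pi> - {{i}}" "x \<in> B" "x \<in> C" for B C x
    using that nc_block_eq[OF assms(2)] by simp
qed

text \<open>A singleton has no two points between which another block could lie, so inserting it
  never turns an outer block of \<open>\<rho>\<close> into an inner one; only the status of
  \<open>{i}\<close> itself has to be recorded.\<close>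

lemma weight_insert_singleton:
  assumes "finite X" "\<rho> \<in> nc key (X - {i})"
  shows "weight key k K (insert {i} \<rho>) = (if inner key (insert {i} \<rho>) {i} then k {i} else K {i}) * weight key k K \<rho>"
proof -
  have i: "{i} \<notin> \<rho>" using nc_subset(1)[OF assms(2)] by auto
  have "inner key (insert {i} \<rho>) V \<longleftrightarrow> inner key \<rho> V" if "V \<in> \<rho>" for V
  proof -
    have "\<not> (\<exists>j\<in>{i}. \<exists>k\<in>{i}. \<forall>x\<in>V. key j < key x \<and> key x < key k)"
      using nc_subset(2)[OF assms(2) that] by (auto dest: less_asym)
    then show ?thesis unfolding inner_def by blast
  qed
  then show ?thesis unfolding weight_def
    using i nc_finite[OF _ assms(2)] assms(1) by (simp cong: prod.cong)
qed

text \<open>Used at an arbitrary point for the shift formula and at the least point for the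
  recursion; in the second case \<open>{i}\<close> is never inner.\<close>

lemma Mom_singleton_split:
  assumes X: "finite X" "i \<in> X"
  shows "Mom key k K X = (\<Sum>\<rho>\<in>nc key (X - {i}). (if inner key (insert {i} \<rho>) {i} then k {i} else K {i}) * weight key k K \<rho>)
     + (\<Sum>\<pi>\<in>{\<pi>\<in>nc key X. {i} \<notin> \<pi>}. weight key k K \<pi>)"
proof -
  have "Mom key k K X = (\<Sum>\<pi>\<in>{\<pi>\<in>nc key X. {i} \<in> \<pi>} \<union> {\<pi>\<in>nc key X. {i} \<notin> \<pi>}. weight key k K \<pi>)"
    unfolding Mom_def by (rule sum.cong) auto
  also have "\<dots> = (\<Sum>\<pi>\<in>{\<pi>\<in>nc key X. {i} \<in> \<pi>}. weight key k K \<pi>) + (\<Sum>\<pi>\<in>{\<pi>\<in>nc key X. {i} \<notin> \<pi>}. weight key k K \<pi>)"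
    by (rule sum.union_disjoint) (auto simp: finite_nc X)
  also have "(\<Sum>\<pi>\<in>{\<pi>\<in>nc key X. {i} \<in> \<pi>}. weight key k K \<pi>) =
      (\<Sum>\<rho>\<in>nc key (X - {i}). (if inner key (insert {i} \<rho>) {i} then k {i} else K {i}) * weight key k K \<rho>)"
  proof (rule sum.reindex_bij_witness[where j="\<lambda>\<pi>. \<pi> - {{i}}" and i="insert {i}"])
    fix \<pi> assume p: "\<pi> \<in> {\<pi>\<in>nc key X. {i} \<in> \<pi>}"
    then show r: "\<pi> - {{i}} \<in> nc key (X - {i})" and e: "insert {i} (\<pi> - {{i}}) = \<pi>"
      using nc_remove_singleton by auto
    show "(if inner key (insert {i} (\<pi> - {{i}})) {i} then k {i} else K {i}) * weight key k K (\<pi> - {{i}}) = weight key k K \<pi>"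
      using weight_insert_singleton[OF X(1) r, of k K] e by simp
  next
    fix \<rho> assume r: "\<rho> \<in> nc key (X - {i})"
    show "insert {i} \<rho> - {{i}} = \<rho>" using nc_subset(1)[OF r] by auto
    show "insert {i} \<rho> \<in> {\<pi> \<in> nc key X. {i} \<in> \<pi>}" using nc_insert_singleton[OF X(2) r] by simp
  qed
  finally show ?thesis .
qed

text \<open>Only partitions having \<open>{i}\<close> as a block notice the change. Since
  \<open>k {i}\<close> and \<open>K {i}\<close> grow by the same \<open>t\<close>, it does not
  matter whether \<open>{i}\<close> is inner, and the increments add up to the full sum over
  partitions of \<open>X - {i}\<close>.\<close>

lemma Mom_shift:
  assumes X: "finite X" "i \<in> X"
  shows "Mom key (k({i} := k {i} + t)) (K({i} := K {i} + t)) X = Mom key k K X + t * Mom key k K (X - {i})"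
proof -
  let ?k = "k({i} := k {i} + t)" and ?K = "K({i} := K {i} + t)"
  have w1: "weight key ?k ?K \<rho> = weight key k K \<rho>" if "\<rho> \<in> nc key (X - {i})" for \<rho>
    unfolding weight_def using nc_subset(1)[OF that] by (intro prod.cong) auto
  have w2: "weight key ?k ?K \<pi> = weight key k K \<pi>" if "{i} \<notin> \<pi>" for \<pi>
    unfolding weight_def using that by (intro prod.cong) auto
  have e1: "(\<Sum>\<rho>\<in>nc key (X - {i}). (if inner key (insert {i} \<rho>) {i} then ?k {i} else ?K {i}) * weight key ?k ?K \<rho>)
    = (\<Sum>\<rho>\<in>nc key (X - {i}). (if inner key (insert {i} \<rho>) {i} then k {i} else K {i}) * weight key k K \<rho>)
      + t * sum (weight key k K) (nc key (X - {i}))"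
    unfolding sum_distrib_left sum.distrib[symmetric]
    by (rule sum.cong[OF refl]) (simp only: w1, simp add: algebra_simps)
  have e2: "sum (weight key ?k ?K) {\<pi>\<in>nc key X. {i} \<notin> \<pi>} = sum (weight key k K) {\<pi>\<in>nc key X. {i} \<notin> \<pi>}"
    by (rule sum.cong[OF refl]) (use w2 in auto)
  show ?thesis
    unfolding Mom_singleton_split[OF X, of key ?k ?K] Mom_singleton_split[OF X, of key k K] Mom_def[of key k K "X - {i}"]
    using e1 e2 by simp
qed


section \<open>Recursion along the block of the least point\<close>

definition attach :: "'x \<Rightarrow> 'x \<Rightarrow> 'x set \<Rightarrow> 'x set" where
  "attach m w B = (if w \<in> B then insert m B else B)"

text \<open>Partitions in which \<open>w\<close> follows \<open>m\<close> directly within a block;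
  as \<open>m\<close> will be the least point of all, \<open>w\<close> is the second point of its
  block.\<close>

definition linked :: "('x \<Rightarrow> 'k::linorder) \<Rightarrow> 'x set \<Rightarrow> 'x \<Rightarrow> 'x \<Rightarrow> 'x set set set" where
  "linked key X m w = {\<pi> \<in> nc key X. \<exists>V\<in>\<pi>. m \<in> V \<and> w \<in> V \<and> (\<forall>v\<in>V. v \<noteq> m \<longrightarrow> key w \<le> key v)}"

text \<open>\<open>G\<close> is the gap that the block of \<open>m\<close> jumps over,
  \<open>Z\<close> the part from \<open>w\<close> on. In \<open>Z\<close> the point \<open>w\<close>
  stands in for \<open>m\<close>, so that a partition in \<open>linked\<close> splits into
  independent partitions of \<open>G\<close> and \<open>Z\<close>.\<close>

context
  fixes key :: "'x \<Rightarrow> 'k::linorder" and m w :: 'x and Y G Z :: "'x set"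
  assumes finY: "finite Y" and inj: "inj_on key Y" and min: "\<And>y. y \<in> Y \<Longrightarrow> key m < key y"
    and wY: "w \<in> Y"
  defines G: "G \<equiv> {y\<in>Y. key y < key w}" and Z: "Z \<equiv> {y\<in>Y. key w \<le> key y}"
begin

lemma mY: "m \<notin> Y" using min by blast

lemma Y_split: "Y = G \<union> Z" "G \<inter> Z = {}" "m \<notin> G" "m \<notin> Z" "w \<in> Z" "w \<notin> G"
  using wY mY by (auto simp: G Z)

lemma gt_in_Y: "\<lbrakk>a \<in> insert m Y; b \<in> insert m Y; key a < key b\<rbrakk> \<Longrightarrow> b \<in> Y"
  using min by (metis insertE less_asym)

lemma attach_linked:
  assumes r1: "\<rho>1 \<in> nc key G" and r2: "\<rho>2 \<in> nc key Z"
  shows "\<rho>1 \<union> attach m w ` \<rho>2 \<in> linked key (insert m Y) m w"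
proof -
  have s1: "B \<subseteq> G" if "B \<in> \<rho>1" for B using nc_subset(1)[OF r1 that] .
  have s2: "B \<subseteq> Z" if "B \<in> \<rho>2" for B using nc_subset(1)[OF r2 that] .
  have s2': "attach m w B \<subseteq> insert m Z" if "B \<in> \<rho>2" for B using s2[OF that] by (auto simp: attach_def)
  obtain W where W: "W \<in> \<rho>2" "w \<in> W" using nc_blockE[OF r2] Y_split by blast
  have un1: "\<Union>\<rho>1 = G" and un2: "\<Union>\<rho>2 = Z" using r1 r2 by (auto simp: nc_def partition_on_def)
  have "\<rho>1 \<union> attach m w ` \<rho>2 \<in> nc key (insert m Y)"
  proof (rule ncI)
    have "\<Union>(attach m w ` \<rho>2) = insert m Z"
    proof
      show "\<Union>(attach m w ` \<rho>2) \<subseteq> insert m Z" using s2' by blast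
      have "B \<subseteq> attach m w B" for B by (auto simp: attach_def)
      moreover have "m \<in> attach m w W" using W by (simp add: attach_def)
      ultimately show "insert m Z \<subseteq> \<Union>(attach m w ` \<rho>2)" using un2 W(1) by blast
    qed
    then show "\<Union>(\<rho>1 \<union> attach m w ` \<rho>2) = insert m Y" using un1 Y_split by auto
    show "B \<noteq> {}" if "B \<in> \<rho>1 \<union> attach m w ` \<rho>2" for B
      using that nc_subset(2)[OF r1] nc_subset(2)[OF r2] by (auto simp: attach_def)
    have disj2: "attach m w B = attach m w C" if "B \<in> \<rho>2" "C \<in> \<rho>2" "x \<in> attach m w B" "x \<in> attach m w C" for B C x
    proof (cases "x = m")
      case True
      then have "w \<in> B" "w \<in> C" using that s2 Y_split by (auto simp: attach_def split: if_splits)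
      then show ?thesis using nc_block_eq[OF r2] that by blast
    next
      case False
      then have "x \<in> B" "x \<in> C" using that by (auto simp: attach_def split: if_splits)
      then show ?thesis using nc_block_eq[OF r2] that by blast
    qed
    show "B = C" if "B \<in> \<rho>1 \<union> attach m w ` \<rho>2" "C \<in> \<rho>1 \<union> attach m w ` \<rho>2" "x \<in> B" "x \<in> C" for B C x
    proof -
      have "\<not> (D \<in> \<rho>1 \<and> E \<in> attach m w ` \<rho>2 \<and> x \<in> D \<and> x \<in> E)" for D E
        using s1 s2' Y_split(2,3) by blast
      then have "B \<in> \<rho>1 \<and> C \<in> \<rho>1 \<or> B \<in> attach m w ` \<rho>2 \<and> C \<in> attach m w ` \<rho>2" using that by blast
      then show ?thesis
      proof
        assume "B \<in> \<rho>1 \<and> C \<in> \<rho>1"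
        then show ?thesis using nc_block_eq[OF r1 _ _ that(3,4)] by simp
      next
        assume "B \<in> attach m w ` \<rho>2 \<and> C \<in> attach m w ` \<rho>2"
        then show ?thesis using that(3,4) disj2 by auto
      qed
    qed
    show "noncrossing key (\<rho>1 \<union> attach m w ` \<rho>2)"
    proof (rule noncrossingI)
      fix B C a b c d
      assume BC: "B \<in> \<rho>1 \<union> attach m w ` \<rho>2" "C \<in> \<rho>1 \<union> attach m w ` \<rho>2"
        and el: "a \<in> B" "c \<in> B" "b \<in> C" "d \<in> C"
        and lt: "key a < key b" "key b < key c" "key c < key d"
      have inX: "D \<subseteq> insert m Y" if "D \<in> \<rho>1 \<union> attach m w ` \<rho>2" for D
        using that s1 s2' Y_split(1) by blast
      have Ys: "b \<in> Y" "c \<in> Y" "d \<in> Y" using gt_in_Y[OF _ _ lt(1)] gt_in_Y[OF _ _ lt(2)] gt_in_Y[OF _ _ lt(3)] el inX[OF BC(1)] inX[OF BC(2)] by auto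
      consider "B \<in> \<rho>1" "C \<in> \<rho>1" | C' where "B \<in> \<rho>1" "C' \<in> \<rho>2" "C = attach m w C'"
        | B' where "B' \<in> \<rho>2" "B = attach m w B'" "C \<in> \<rho>1"
        | B' C' where "B' \<in> \<rho>2" "B = attach m w B'" "C' \<in> \<rho>2" "C = attach m w C'"
        using BC by blast
      then show "B = C"
      proof cases
        case 1
        then show ?thesis using noncrossingD[OF _ 1 el lt] r1 by (simp add: nc_def)
      next
        case 2
        have "c \<in> G" using s1 2 el by blast
        moreover have "b \<in> Z" using s2'[OF 2(2)] 2 el Ys mY by blast
        ultimately show ?thesis using lt by (auto simp: G Z)
      next
        case 3
        have "d \<in> G" using s1 3 el by blast
        moreover have "c \<in> Z" using s2'[OF 3(1)] 3 el Ys mY by blast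
        ultimately show ?thesis using lt by (auto simp: G Z)
      next
        case 4
        have ncr: "noncrossing key \<rho>2" using r2 by (simp add: nc_def)
        have e: "c \<in> B'" "b \<in> C'" "d \<in> C'" using 4 el Ys mY by (auto simp: attach_def split: if_splits)
        \<comment> \<open>A crossing that starts at \<open>m\<close> is replayed from
          \<open>w\<close>, which lies in the same block and is the least point of \<open>Z\<close>;
          only \<open>b = w\<close> is exceptional, and then the two blocks share
          \<open>w\<close>.\<close>
        have "B' = C'"
        proof (cases "a = m")
          case True
          then have "w \<in> B'" using 4 el s2 Y_split by (auto simp: attach_def split: if_splits)
          show ?thesis
          proof (cases "b = w")
            case True
            then show ?thesis using nc_block_eq[OF r2] 4 e \<open>w \<in> B'\<close> by blast
          next
            case False
            have "b \<in> Z" using s2 4 e by blast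
            then have "key w < key b" using False inj wY Ys by (auto simp: Z inj_on_def order.order_iff_strict)
            then show ?thesis using noncrossingD[OF ncr 4(1,3) \<open>w \<in> B'\<close> e _ lt(2,3)] by simp
          qed
        next
          case False
          then have "a \<in> B'" using 4 el by (auto simp: attach_def split: if_splits)
          then show ?thesis using noncrossingD[OF ncr 4(1,3) _ e lt] by simp
        qed
        then show ?thesis using 4 by simp
      qed
    qed
  qed
  moreover have "\<exists>V\<in>\<rho>1 \<union> attach m w ` \<rho>2. m \<in> V \<and> w \<in> V \<and> (\<forall>v\<in>V. v \<noteq> m \<longrightarrow> key w \<le> key v)"
    by (rule bexI[of _ "attach m w W"]) (use W s2[OF W(1)] in \<open>auto simp: attach_def Z\<close>)
  ultimately show ?thesis by (simp add: linked_def)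
qed

text \<open>A block with a point \<open>x\<close> of the gap and a point \<open>y\<close> beyond
  \<open>w\<close> would cross the block of \<open>m\<close> in the order \<open>m\<close>,
  \<open>x\<close>, \<open>w\<close>, \<open>y\<close>; so the gap is a union of blocks.\<close>

lemma linked_blocks:
  assumes "\<pi> \<in> linked key (insert m Y) m w" "B \<in> \<pi>"
  shows "B \<subseteq> G \<or> B \<subseteq> insert m Z" "m \<in> B \<longleftrightarrow> w \<in> B"
proof -
  from assms(1) obtain V where p: "\<pi> \<in> nc key (insert m Y)" and V: "V \<in> \<pi>" "m \<in> V" "w \<in> V"
    and le: "\<And>v. v \<in> V \<Longrightarrow> v \<noteq> m \<Longrightarrow> key w \<le> key v" by (auto simp: linked_def)
  have ncr: "noncrossing key \<pi>" using p by (simp add: nc_def)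
  show mw: "m \<in> B \<longleftrightarrow> w \<in> B" using nc_block_eq[OF p assms(2) V(1)] V by blast
  have "False" if x: "x \<in> B" "x \<in> G" and y: "y \<in> B" "y \<in> insert m Z" for x y
  proof -
    have "x \<noteq> m" using x mY by (auto simp: G)
    then have "x \<notin> V" using le[of x] x by (auto simp: G)
    then have "B \<noteq> V" using x by blast
    then have "m \<notin> B" "w \<notin> B" using nc_block_eq[OF p assms(2) V(1)] V by blast+
    then have "y \<noteq> m" "y \<noteq> w" using y by blast+
    then have "y \<in> Z" using y by simp
    then have "key w < key y" using \<open>y \<noteq> w\<close> inj wY by (auto simp: Z inj_on_def order.order_iff_strict)
    moreover have "key m < key x" "key x < key w" using x min by (auto simp: G)
    ultimately have "V = B" using noncrossingD[OF ncr V(1) assms(2) V(2,3) x(1) y(1)] by simp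
    then show False using \<open>B \<noteq> V\<close> by simp
  qed
  moreover have "B \<subseteq> insert m (G \<union> Z)" using nc_subset(1)[OF p assms(2)] Y_split(1) by simp
  ultimately show "B \<subseteq> G \<or> B \<subseteq> insert m Z" by blast
qed

lemma linked_gap:
  assumes "\<pi> \<in> linked key (insert m Y) m w"
  shows "{B\<in>\<pi>. B \<subseteq> G} \<in> nc key G"
proof -
  have p: "\<pi> \<in> nc key (insert m Y)" using assms by (simp add: linked_def)
  show ?thesis
  proof (rule ncI)
    have "x \<in> \<Union>{B\<in>\<pi>. B \<subseteq> G}" if x: "x \<in> G" for x
    proof -
      obtain B where "B \<in> \<pi>" "x \<in> B" using nc_blockE[OF p] x Y_split(1) by blast
      then show ?thesis using linked_blocks(1)[OF assms] x Y_split(2,3) by blast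
    qed
    then show "\<Union>{B\<in>\<pi>. B \<subseteq> G} = G" by auto
    show "B \<noteq> {}" if "B \<in> {B\<in>\<pi>. B \<subseteq> G}" for B using that nc_subset(2)[OF p] by simp
    show "B = C" if "B \<in> {B\<in>\<pi>. B \<subseteq> G}" "C \<in> {B\<in>\<pi>. B \<subseteq> G}" "x \<in> B" "x \<in> C" for B C x
      using that nc_block_eq[OF p] by simp
    have "noncrossing key \<pi>" using p by (simp add: nc_def)
    then show "noncrossing key {B\<in>\<pi>. B \<subseteq> G}" by (rule noncrossing_subset) simp
  qed
qed

lemma linked_rest:
  assumes "\<pi> \<in> linked key (insert m Y) m w"
  shows "(\<lambda>B. B - {m}) ` {B\<in>\<pi>. \<not> B \<subseteq> G} \<in> nc key Z"
proof -
  have p: "\<pi> \<in> nc key (insert m Y)" using assms by (simp add: linked_def)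
  note bl = linked_blocks[OF assms]
  show ?thesis
  proof (rule ncI)
    have "x \<in> \<Union>((\<lambda>B. B - {m}) ` {B\<in>\<pi>. \<not> B \<subseteq> G})" if x: "x \<in> Z" for x
    proof -
      obtain B where "B \<in> \<pi>" "x \<in> B" using nc_blockE[OF p] x Y_split(1) by blast
      then show ?thesis using x Y_split(2,4) by blast
    qed
    then show "\<Union>((\<lambda>B. B - {m}) ` {B\<in>\<pi>. \<not> B \<subseteq> G}) = Z" using bl(1) by blast
    show "B \<noteq> {}" if "B \<in> (\<lambda>B. B - {m}) ` {B\<in>\<pi>. \<not> B \<subseteq> G}" for B
      using that bl(2) nc_subset(2)[OF p] wY mY by blast
    show "B = C" if "B \<in> (\<lambda>B. B - {m}) ` {B\<in>\<pi>. \<not> B \<subseteq> G}" "C \<in> (\<lambda>B. B - {m}) ` {B\<in>\<pi>. \<not> B \<subseteq> G}" "x \<in> B" "x \<in> C" for B C x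
      using that nc_block_eq[OF p] by blast
    have ncr: "noncrossing key \<pi>" using p by (simp add: nc_def)
    show "noncrossing key ((\<lambda>B. B - {m}) ` {B\<in>\<pi>. \<not> B \<subseteq> G})"
    proof (rule noncrossingI)
      fix B C a b c d
      assume BC: "B \<in> (\<lambda>B. B - {m}) ` {B\<in>\<pi>. \<not> B \<subseteq> G}" "C \<in> (\<lambda>B. B - {m}) ` {B\<in>\<pi>. \<not> B \<subseteq> G}"
        and el: "a \<in> B" "c \<in> B" "b \<in> C" "d \<in> C"
        and lt: "key a < key b" "key b < key c" "key c < key d"
      then obtain B' C' where "B' \<in> \<pi>" "C' \<in> \<pi>" "B = B' - {m}" "C = C' - {m}" by blast
      then show "B = C" using noncrossingD[OF ncr, of B' C' a c b d] el lt by blast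
    qed
  qed
qed

lemma linked_attach_inverse:
  assumes "\<pi> \<in> linked key (insert m Y) m w"
  shows "{B\<in>\<pi>. B \<subseteq> G} \<union> attach m w ` (\<lambda>B. B - {m}) ` {B\<in>\<pi>. \<not> B \<subseteq> G} = \<pi>"
proof -
  have "attach m w (B - {m}) = B" if "B \<in> \<pi>" for B
    using linked_blocks(2)[OF assms that] wY mY by (auto simp: attach_def)
  then have "attach m w ` (\<lambda>B. B - {m}) ` {B\<in>\<pi>. \<not> B \<subseteq> G} = {B\<in>\<pi>. \<not> B \<subseteq> G}"
    by (force simp: image_iff)
  then show ?thesis by auto
qed

lemma attach_minus: "B \<subseteq> Z \<Longrightarrow> attach m w B - {m} = B"
  using Y_split(4) by (auto simp: attach_def)

lemma attach_not_subset: "B \<subseteq> Z \<Longrightarrow> B \<noteq> {} \<Longrightarrow> \<not> attach m w B \<subseteq> G"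
  using Y_split(2) by (auto simp: attach_def split: if_splits)

lemma attach_linked_gap:
  assumes r1: "\<rho>1 \<in> nc key G" and r2: "\<rho>2 \<in> nc key Z"
  shows "{B\<in>\<rho>1 \<union> attach m w ` \<rho>2. B \<subseteq> G} = \<rho>1"
  using nc_subset(1)[OF r1] attach_not_subset[OF nc_subset[OF r2]] by auto

lemma attach_linked_rest:
  assumes r1: "\<rho>1 \<in> nc key G" and r2: "\<rho>2 \<in> nc key Z"
  shows "(\<lambda>B. B - {m}) ` {B\<in>\<rho>1 \<union> attach m w ` \<rho>2. \<not> B \<subseteq> G} = \<rho>2"
proof -
  have "{B\<in>\<rho>1 \<union> attach m w ` \<rho>2. \<not> B \<subseteq> G} = attach m w ` \<rho>2"
    using nc_subset(1)[OF r1] attach_not_subset[OF nc_subset[OF r2]] by auto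
  then show ?thesis using attach_minus[OF nc_subset(1)[OF r2]] by (simp add: image_image)
qed

text \<open>Gap blocks lie between \<open>m\<close> and \<open>w\<close>, hence are inner whatever
  their status in \<open>\<rho>1\<close>: the factor for \<open>G\<close> carries \<open>k\<close>
  twice. The block of \<open>w\<close> is outer because \<open>w\<close> is least in
  \<open>Z\<close>, and attaching \<open>m\<close> keeps it outer; so \<open>m\<close> is recorded
  by changing the outer weight alone.\<close>

lemma weight_attach:
  assumes r1: "\<rho>1 \<in> nc key G" and r2: "\<rho>2 \<in> nc key Z"
  shows "weight key k K (\<rho>1 \<union> attach m w ` \<rho>2) = weight key k k \<rho>1 * weight key k (\<lambda>B. K (attach m w B)) \<rho>2"
proof -
  let ?\<pi> = "\<rho>1 \<union> attach m w ` \<rho>2"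
  have s1: "B \<subseteq> G" if "B \<in> \<rho>1" for B using nc_subset(1)[OF r1 that] .
  have s2: "B \<subseteq> Z" "B \<noteq> {}" if "B \<in> \<rho>2" for B using nc_subset[OF r2 that] .
  obtain W where W: "W \<in> \<rho>2" "w \<in> W" using nc_blockE[OF r2] Y_split by blast
  have fin: "finite \<rho>1" "finite \<rho>2" using nc_finite[OF _ r1] nc_finite[OF _ r2] finY by (auto simp: G Z)
  have "attach m w B \<notin> \<rho>1" if "B \<in> \<rho>2" for B
    using s1[of "attach m w B"] attach_not_subset[OF s2[OF that]] by blast
  then have disj: "\<rho>1 \<inter> attach m w ` \<rho>2 = {}" by auto
  have inja: "inj_on (attach m w) \<rho>2" by (rule inj_onI) (metis attach_minus s2(1))
  have in1: "inner key ?\<pi> B" if B: "B \<in> \<rho>1" for B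
  proof -
    have "attach m w W \<in> ?\<pi>" "m \<in> attach m w W" "w \<in> attach m w W" using W by (auto simp: attach_def)
    moreover have "attach m w W \<noteq> B" using \<open>w \<in> attach m w W\<close> s1[OF B] Y_split(6) by blast
    moreover have "\<forall>i\<in>B. key m < key i \<and> key i < key w" using s1[OF B] min by (auto simp: G)
    ultimately show ?thesis by (intro innerI[of "attach m w W" _ _ m w]) simp_all
  qed
  \<comment> \<open>Attaching \<open>m\<close> creates no new enclosure in \<open>Z\<close>: blocks
    of the gap end before \<open>w\<close>, and if \<open>m\<close> is the left end of an enclosure,
    then \<open>w\<close> serves as well.\<close>
  have in2: "inner key ?\<pi> (attach m w B) \<longleftrightarrow> inner key \<rho>2 B" if B: "B \<in> \<rho>2" for B
  proof
    assume "inner key ?\<pi> (attach m w B)"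
    then obtain C j k where C: "C \<in> ?\<pi>" "C \<noteq> attach m w B" "j \<in> C" "k \<in> C"
      and lt: "\<And>i. i \<in> attach m w B \<Longrightarrow> key j < key i" "\<And>i. i \<in> attach m w B \<Longrightarrow> key i < key k"
      by (rule innerE) blast
    have sub: "B \<subseteq> attach m w B" by (auto simp: attach_def)
    obtain i0 where i0: "i0 \<in> B" using s2(2)[OF B] by blast
    have i0Z: "i0 \<in> Z" using i0 s2(1)[OF B] by blast
    have "C \<notin> \<rho>1"
    proof
      assume "C \<in> \<rho>1"
      then have "key k < key w" using s1 C by (auto simp: G)
      moreover have "key i0 < key k" using lt i0 sub by blast
      ultimately show False using i0Z by (auto simp: Z)
    qed
    then obtain C' where C': "C' \<in> \<rho>2" "C = attach m w C'" using C(1) by blast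
    have "C' \<noteq> B" using C C' by blast
    have "key i0 < key k" "key m < key i0" using lt[of i0] i0 i0Z sub min[of i0] by (auto simp: Z)
    then have "k \<noteq> m" by auto
    then have "k \<in> C'" using C C' by (auto simp: attach_def split: if_splits)
    show "inner key \<rho>2 B"
    proof (cases "j = m")
      case False
      then have "j \<in> C'" using C C' by (auto simp: attach_def split: if_splits)
      show ?thesis by (rule innerI[OF C'(1) \<open>C' \<noteq> B\<close> \<open>j \<in> C'\<close> \<open>k \<in> C'\<close>]) (use lt sub in auto)
    next
      case True
      then have wC: "w \<in> C'" using C C' s2(1)[OF C'(1)] Y_split(4) by (auto simp: attach_def split: if_splits)
      have "key w < key i" if i: "i \<in> B" for i
      proof -
        have "i \<noteq> w" using nc_block_eq[OF r2 C'(1) B wC] i \<open>C' \<noteq> B\<close> by blast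
        moreover have "i \<in> Z" using i s2(1)[OF B] by blast
        ultimately show ?thesis using inj wY by (auto simp: Z inj_on_def order.order_iff_strict)
      qed
      then show ?thesis by (rule innerI[OF C'(1) \<open>C' \<noteq> B\<close> wC \<open>k \<in> C'\<close>]) (use lt sub in auto)
    qed
  next
    assume "inner key \<rho>2 B"
    then obtain C j k where C: "C \<in> \<rho>2" "C \<noteq> B" "j \<in> C" "k \<in> C"
      and lt: "\<And>i. i \<in> B \<Longrightarrow> key j < key i" "\<And>i. i \<in> B \<Longrightarrow> key i < key k"
      by (rule innerE) blast
    have "w \<notin> B"
    proof
      assume "w \<in> B"
      then have "key j < key w" using lt by blast
      then show False using s2(1)[OF C(1)] C(3) by (auto simp: Z)
    qed
    then have aB: "attach m w B = B" by (simp add: attach_def)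
    have "attach m w C \<noteq> attach m w B" using inja C B by (auto simp: inj_on_def)
    moreover have "j \<in> attach m w C" "k \<in> attach m w C" "attach m w C \<in> ?\<pi>" using C by (auto simp: attach_def)
    ultimately show "inner key ?\<pi> (attach m w B)" using lt aB by (intro innerI[of "attach m w C" _ _ j k]) simp_all
  qed
  \<comment> \<open>An inner block cannot contain the least point \<open>w\<close>, so its weight
    \<open>k B\<close> is untouched by attaching.\<close>
  have aw: "attach m w B = B" if B: "B \<in> \<rho>2" "inner key \<rho>2 B" for B
  proof -
    have "w \<notin> B"
    proof
      assume "w \<in> B"
      then obtain C j where "C \<in> \<rho>2" "j \<in> C" "key j < key w" using B(2) by (auto elim!: innerE)
      then show False using s2(1)[of C] by (auto simp: Z)
    qed
    then show ?thesis by (simp add: attach_def)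
  qed
  have "weight key k K ?\<pi> = (\<Prod>V\<in>\<rho>1. if inner key ?\<pi> V then k V else K V) *
     (\<Prod>V\<in>attach m w ` \<rho>2. if inner key ?\<pi> V then k V else K V)"
    unfolding weight_def by (rule prod.union_disjoint) (use fin disj in auto)
  also have "(\<Prod>V\<in>\<rho>1. if inner key ?\<pi> V then k V else K V) = weight key k k \<rho>1"
    unfolding weight_def by (rule prod.cong) (simp_all add: in1)
  also have "(\<Prod>V\<in>attach m w ` \<rho>2. if inner key ?\<pi> V then k V else K V) = weight key k (\<lambda>B. K (attach m w B)) \<rho>2"
    unfolding weight_def prod.reindex[OF inja] by (rule prod.cong) (simp_all add: in2 aw)
  finally show ?thesis .
qed

lemma sum_linked:
  "(\<Sum>\<pi>\<in>linked key (insert m Y) m w. weight key k K \<pi>) = Mom key k k G * Mom key k (\<lambda>B. K (attach m w B)) Z"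
proof -
  have "(\<Sum>\<pi>\<in>linked key (insert m Y) m w. weight key k K \<pi>) =
    (\<Sum>(\<rho>1, \<rho>2)\<in>nc key G \<times> nc key Z. weight key k k \<rho>1 * weight key k (\<lambda>B. K (attach m w B)) \<rho>2)"
  proof (rule sum.reindex_bij_witness[where j="\<lambda>\<pi>. ({B\<in>\<pi>. B \<subseteq> G}, (\<lambda>B. B - {m}) ` {B\<in>\<pi>. \<not> B \<subseteq> G})"
        and i="\<lambda>(\<rho>1, \<rho>2). \<rho>1 \<union> attach m w ` \<rho>2"])
    fix \<pi> assume p: "\<pi> \<in> linked key (insert m Y) m w"
    show "(case ({B\<in>\<pi>. B \<subseteq> G}, (\<lambda>B. B - {m}) ` {B\<in>\<pi>. \<not> B \<subseteq> G}) of (\<rho>1, \<rho>2) \<Rightarrow> \<rho>1 \<union> attach m w ` \<rho>2) = \<pi>"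
      using linked_attach_inverse[OF p] by simp
    show "({B\<in>\<pi>. B \<subseteq> G}, (\<lambda>B. B - {m}) ` {B\<in>\<pi>. \<not> B \<subseteq> G}) \<in> nc key G \<times> nc key Z"
      using linked_gap[OF p] linked_rest[OF p] by simp
    show "(case ({B\<in>\<pi>. B \<subseteq> G}, (\<lambda>B. B - {m}) ` {B\<in>\<pi>. \<not> B \<subseteq> G}) of
        (\<rho>1, \<rho>2) \<Rightarrow> weight key k k \<rho>1 * weight key k (\<lambda>B. K (attach m w B)) \<rho>2) = weight key k K \<pi>"
      using weight_attach[OF linked_gap[OF p] linked_rest[OF p], of k K] linked_attach_inverse[OF p] by simp
  next
    fix r assume "r \<in> nc key G \<times> nc key Z"
    then obtain \<rho>1 \<rho>2 where r: "r = (\<rho>1, \<rho>2)" "\<rho>1 \<in> nc key G" "\<rho>2 \<in> nc key Z" by blast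
    show "({B\<in>case r of (\<rho>1, \<rho>2) \<Rightarrow> \<rho>1 \<union> attach m w ` \<rho>2. B \<subseteq> G},
        (\<lambda>B. B - {m}) ` {B\<in>case r of (\<rho>1, \<rho>2) \<Rightarrow> \<rho>1 \<union> attach m w ` \<rho>2. \<not> B \<subseteq> G}) = r"
      unfolding r(1) prod.case attach_linked_gap[OF r(2,3)] attach_linked_rest[OF r(2,3)] ..
    show "(case r of (\<rho>1, \<rho>2) \<Rightarrow> \<rho>1 \<union> attach m w ` \<rho>2) \<in> linked key (insert m Y) m w"
      unfolding r(1) prod.case by (rule attach_linked[OF r(2,3)])
  qed
  also have "\<dots> = Mom key k k G * Mom key k (\<lambda>B. K (attach m w B)) Z"
    unfolding Mom_def sum_product sum.cartesian_product ..
  finally show ?thesis .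
qed

end

lemma Mom_rec:
  fixes key :: "'x \<Rightarrow> 'k::linorder"
  assumes fin: "finite Y" and inj: "inj_on key Y" and min: "\<And>y. y \<in> Y \<Longrightarrow> key m < key y"
  shows "Mom key k K (insert m Y) = K {m} * Mom key k K Y +
    (\<Sum>w\<in>Y. Mom key k k {y\<in>Y. key y < key w} * Mom key k (\<lambda>B. K (attach m w B)) {y\<in>Y. key w \<le> key y})"
proof -
  let ?X = "insert m Y"
  have mY: "m \<notin> Y" using min by blast
  have *: "\<not> inner key (insert {m} \<rho>) {m}" if "\<rho> \<in> nc key Y" for \<rho>
  proof
    assume "inner key (insert {m} \<rho>) {m}"
    then obtain C j where C: "C \<in> insert {m} \<rho>" "j \<in> C" "key j < key m" by (auto elim!: innerE)
    then have "j \<in> insert m Y" using nc_subset(1)[OF that] by blast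
    then show False using C min by (metis insertE less_asym less_irrefl)
  qed
  \<comment> \<open>A block of \<open>m\<close> with more than one point has a second least point
    \<open>w\<close>, unique by injectivity of the key, so the classes \<open>linked\<close> are
    disjoint and exhaust these partitions.\<close>
  have "{\<pi>\<in>nc key ?X. {m} \<notin> \<pi>} = (\<Union>w\<in>Y. linked key ?X m w)"
  proof (intro equalityI subsetI)
    fix \<pi> assume p: "\<pi> \<in> {\<pi>\<in>nc key ?X. {m} \<notin> \<pi>}"
    then have p': "\<pi> \<in> nc key ?X" by simp
    obtain V where V: "V \<in> \<pi>" "m \<in> V" using nc_blockE[OF p', of m] by blast
    have VX: "V \<subseteq> ?X" using nc_subset(1)[OF p' V(1)] .
    have "V \<noteq> {m}" using V p by auto
    then have "V - {m} \<noteq> {}" using V(2) by auto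
    moreover have "finite (V - {m})" using VX fin by (meson finite.insertI finite_Diff finite_subset)
    ultimately obtain w where w: "w \<in> V - {m}" "\<And>v. v \<in> V - {m} \<Longrightarrow> key w \<le> key v"
      using arg_min_if_finite(1)[of "V - {m}" key] arg_min_least[of "V - {m}" _ key] by blast
    have "\<pi> \<in> linked key ?X m w" unfolding linked_def using p' V w by blast
    moreover have "w \<in> Y" using w VX by blast
    ultimately show "\<pi> \<in> (\<Union>w\<in>Y. linked key ?X m w)" by blast
  next
    fix \<pi> assume "\<pi> \<in> (\<Union>w\<in>Y. linked key ?X m w)"
    then obtain w V where w: "w \<in> Y" "\<pi> \<in> nc key ?X" "V \<in> \<pi>" "m \<in> V" "w \<in> V" by (auto simp: linked_def)
    have "{m} \<notin> \<pi>" using nc_block_eq[OF w(2,3), of "{m}" m] w mY by blast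
    then show "\<pi> \<in> {\<pi>\<in>nc key ?X. {m} \<notin> \<pi>}" using w by simp
  qed
  moreover have "(\<Sum>\<pi>\<in>(\<Union>w\<in>Y. linked key ?X m w). weight key k K \<pi>) = (\<Sum>w\<in>Y. \<Sum>\<pi>\<in>linked key ?X m w. weight key k K \<pi>)"
  proof (rule sum.UNION_disjoint)
    show "finite Y" by fact
    show "\<forall>w\<in>Y. finite (linked key ?X m w)"
      unfolding linked_def using finite_nc[of ?X key] fin by simp
    show "\<forall>w\<in>Y. \<forall>v\<in>Y. w \<noteq> v \<longrightarrow> linked key ?X m w \<inter> linked key ?X m v = {}"
    proof (intro ballI impI)
      fix v w assume vw: "w \<in> Y" "v \<in> Y" "w \<noteq> v"
      have False if "\<pi> \<in> linked key ?X m w" "\<pi> \<in> linked key ?X m v" for \<pi>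
      proof -
        from that obtain V W where p: "\<pi> \<in> nc key ?X" and
          V: "V \<in> \<pi>" "m \<in> V" "w \<in> V" "\<forall>x\<in>V. x \<noteq> m \<longrightarrow> key w \<le> key x" and
          W: "W \<in> \<pi>" "m \<in> W" "v \<in> W" "\<forall>x\<in>W. x \<noteq> m \<longrightarrow> key v \<le> key x" by (auto simp: linked_def)
        have "V = W" using nc_block_eq[OF p V(1) W(1) V(2) W(2)] .
        then have "key v = key w" using V W vw mY by (metis order_antisym)
        then show False using inj vw by (auto simp: inj_on_def)
      qed
      then show "linked key ?X m w \<inter> linked key ?X m v = {}" by blast
    qed
  qed
  moreover have "(\<Sum>\<pi>\<in>linked key ?X m w. weight key k K \<pi>) =
      Mom key k k {y\<in>Y. key y < key w} * Mom key k (\<lambda>B. K (attach m w B)) {y\<in>Y. key w \<le> key y}" if "w \<in> Y" for w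
    by (rule sum_linked[OF fin inj min that])
  ultimately have "(\<Sum>\<pi>\<in>{\<pi>\<in>nc key ?X. {m} \<notin> \<pi>}. weight key k K \<pi>) =
     (\<Sum>w\<in>Y. Mom key k k {y\<in>Y. key y < key w} * Mom key k (\<lambda>B. K (attach m w B)) {y\<in>Y. key w \<le> key y})"
    by simp
  moreover have "(\<Sum>\<rho>\<in>nc key (?X - {m}). (if inner key (insert {m} \<rho>) {m} then k {m} else K {m}) * weight key k K \<rho>)
     = K {m} * Mom key k K Y"
    using mY * by (simp add: Mom_def sum_distrib_left)
  ultimately show ?thesis using Mom_singleton_split[of ?X m key k K] fin by simp
qed


section \<open>Factorisation over consecutive levels\<close>

lemma Mom_min_vanish:
  assumes "finite X" "w \<in> X" "\<And>x. x \<in> X \<Longrightarrow> key w \<le> key x" "\<And>B. w \<in> B \<Longrightarrow> K B = 0"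
  shows "Mom key k K X = 0"
  unfolding Mom_def
proof (rule sum.neutral, rule ballI)
  fix \<pi> assume p: "\<pi> \<in> nc key X"
  obtain W where W: "W \<in> \<pi>" "w \<in> W" using nc_blockE[OF p assms(2)] .
  \<comment> \<open>No point lies to the left of \<open>w\<close>, so its block cannot be enclosed
    and contributes the vanishing factor \<open>K W\<close>.\<close>
  have "\<not> inner key \<pi> W"
  proof
    assume "inner key \<pi> W"
    then obtain C j where "C \<in> \<pi>" "j \<in> C" "key j < key w" using W(2) by (auto elim!: innerE)
    then show False using assms(3)[of j] nc_subset(1)[OF p] by force
  qed
  then show "weight key k K \<pi> = 0"
    unfolding weight_def using W nc_finite[OF assms(1) p] assms(4) by (intro prod_zero) auto
qed

definition level :: "('x \<Rightarrow> nat) \<Rightarrow> 'x set \<Rightarrow> nat \<Rightarrow> 'x set" where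
  "level idx X i = {x\<in>X. idx x = i}"

lemma Mom_factor:
  fixes key :: "'x \<Rightarrow> 'k::linorder" and idx :: "'x \<Rightarrow> nat" and col :: "nat \<Rightarrow> 'c"
  assumes inj: "inj key"
    and k: "\<And>B x y. x \<in> B \<Longrightarrow> y \<in> B \<Longrightarrow> col (idx x) \<noteq> col (idx y) \<Longrightarrow> k B = 0"
  shows "\<lbrakk>finite X; \<And>x. x \<in> X \<Longrightarrow> a \<le> idx x \<and> idx x \<le> b;
      \<And>x y. x \<in> X \<Longrightarrow> y \<in> X \<Longrightarrow> key x < key y \<Longrightarrow> idx x \<le> idx y;
      \<And>i. a \<le> i \<Longrightarrow> i < b \<Longrightarrow> col i \<noteq> col (Suc i);
      \<And>i. a < i \<Longrightarrow> i < b \<Longrightarrow> Mom key k k (level idx X i) = 0;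
      \<And>B x y. x \<in> B \<Longrightarrow> y \<in> B \<Longrightarrow> col (idx x) \<noteq> col (idx y) \<Longrightarrow> K B = 0\<rbrakk> \<Longrightarrow>
    Mom key k K X = (\<Prod>i=a..b. Mom key k K (level idx X i))"
proof (induction "card X + (Suc b - a)" arbitrary: X a b K rule: less_induct)
  case less
  note fin = less.prems(1) and rng = less.prems(2) and mon = less.prems(3)
    and alt = less.prems(4) and cen = less.prems(5) and K = less.prems(6)
  note IH = less.hyps
  consider "X = {}" | "X \<noteq> {}" "level idx X a = {}" | "level idx X a \<noteq> {}" by blast
  then show ?case
  proof cases
    case 1
    then show ?thesis by (simp add: level_def)
  next
    case 2
    then obtain x where "x \<in> X" by blast
    then have ab: "a \<le> b" using rng[of x] by simp
    have "Mom key k K X = (\<Prod>i=Suc a..b. Mom key k K (level idx X i))"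
    proof (rule IH)
      show "card X + (Suc b - Suc a) < card X + (Suc b - a)" using ab by simp
      show "Suc a \<le> idx x \<and> idx x \<le> b" if "x \<in> X" for x
        using rng[OF that] 2(2) that by (auto simp: level_def Suc_le_eq order.order_iff_strict)
    qed (use fin mon alt cen K in auto)
    then show ?thesis using ab 2 by (simp add: prod.atLeast_Suc_atMost)
  next
    case 3
    then obtain x0 where x0: "x0 \<in> X" "idx x0 = a" by (auto simp: level_def)
    have ab: "a \<le> b" using rng[of x0] x0 by simp
    have Xne: "X \<noteq> {}" using x0 by blast
    define m where "m = arg_min_on key X"
    have mX: "m \<in> X" unfolding m_def by (rule arg_min_if_finite(1)[OF fin Xne])
    have mle: "key m \<le> key x" if "x \<in> X" for x unfolding m_def by (rule arg_min_least[OF fin Xne that])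
    define Y where "Y = X - {m}"
    have XY: "X = insert m Y" using mX by (auto simp: Y_def)
    have YX: "Y \<subseteq> X" by (auto simp: Y_def)
    have rngY: "a \<le> idx x \<and> idx x \<le> b" if "x \<in> Y" for x using rng that YX by blast
    have monY: "idx x \<le> idx y" if "x \<in> Y" "y \<in> Y" "key x < key y" for x y using mon that YX by blast
    have finY: "finite Y" using fin by (simp add: Y_def)
    have mlt: "key m < key y" if "y \<in> Y" for y
      using mle[of y] that inj by (auto simp: Y_def inj_def order.order_iff_strict)
    have ma: "idx m = a"
    proof (cases "m = x0")
      case False
      then have "key m < key x0" using mlt x0 by (auto simp: Y_def)
      then have "idx m \<le> a" using mon[OF mX x0(1)] x0 by simp
      then show ?thesis using rng[OF mX] by simp
    qed (use x0 in simp)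
    have cardY: "card X = Suc (card Y)" using finY XY by (metis Y_def DiffE card_insert_disjoint insertI1)
    define J where "J = level idx Y a"
    have JX: "level idx X a = insert m J" using ma by (auto simp: XY J_def level_def)
    have JY: "J \<subseteq> Y" by (auto simp: J_def level_def)
    have levY: "level idx Y i = level idx X i" if "i \<noteq> a" for i using that ma by (auto simp: XY level_def)
    define P where "P = (\<Prod>i=Suc a..b. Mom key k K (level idx X i))"
    have injY: "inj_on key Y" "inj_on key J" using inj by (auto intro: inj_on_subset)
    \<comment> \<open>\<open>t0\<close>, \<open>t1\<close> and \<open>t2\<close> evaluate the three
      kinds of terms of the recursion: \<open>m\<close> alone in its block, \<open>w\<close> in the
      interval of \<open>m\<close>, and \<open>w\<close> beyond it.\<close>
    have t0: "Mom key k K Y = Mom key k K J * P"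
    proof -
      have "Mom key k K Y = (\<Prod>i=a..b. Mom key k K (level idx Y i))"
      proof (rule IH)
        show "card Y + (Suc b - a) < card X + (Suc b - a)" using cardY by simp
      qed (use finY rngY monY alt cen K levY in auto)
      also have "\<dots> = Mom key k K J * (\<Prod>i=Suc a..b. Mom key k K (level idx Y i))"
        using ab by (simp add: prod.atLeast_Suc_atMost J_def)
      also have "(\<Prod>i=Suc a..b. Mom key k K (level idx Y i)) = P"
        unfolding P_def by (rule prod.cong) (simp_all add: levY)
      finally show ?thesis .
    qed
    have t1: "Mom key k (\<lambda>B. K (attach m w B)) {y\<in>Y. key w \<le> key y} =
        Mom key k (\<lambda>B. K (attach m w B)) {y\<in>J. key w \<le> key y} * P" if w: "w \<in> J" for w
    proof -
      let ?Z = "{y\<in>Y. key w \<le> key y}" and ?K = "\<lambda>B. K (attach m w B)"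
      have wY: "w \<in> Y" and wa: "idx w = a" using w by (auto simp: J_def level_def)
      have lev: "level idx ?Z i = level idx X i" if "i > a" for i
      proof -
        have "key w \<le> key x" if "x \<in> Y" "idx x = i" for x
          using monY[of x w] that wY wa \<open>i > a\<close> by force
        then have "level idx ?Z i = level idx Y i" by (auto simp: level_def)
        then show ?thesis using levY[of i] that by simp
      qed
      have Ka: "?K B = 0" if "x \<in> B" "y \<in> B" "col (idx x) \<noteq> col (idx y)" for B x y
        using K[of x "attach m w B" y] that by (simp add: attach_def)
      have "Mom key k ?K ?Z = (\<Prod>i=a..b. Mom key k ?K (level idx ?Z i))"
      proof (rule IH)
        have "card ?Z \<le> card Y" using finY by (intro card_mono) auto
        then show "card ?Z + (Suc b - a) < card X + (Suc b - a)" using cardY by simp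
        show "Mom key k k (level idx ?Z i) = 0" if "a < i" "i < b" for i using cen[OF that] lev[OF that(1)] by simp
        show "K (attach m w B) = 0" if "x \<in> B" "y \<in> B" "col (idx x) \<noteq> col (idx y)" for B x y
          using Ka[OF that] .
      qed (use finY rngY monY alt in auto)
      also have "\<dots> = Mom key k ?K (level idx ?Z a) * (\<Prod>i=Suc a..b. Mom key k ?K (level idx ?Z i))"
        using ab by (simp add: prod.atLeast_Suc_atMost)
      also have "level idx ?Z a = {y\<in>J. key w \<le> key y}" by (auto simp: J_def level_def)
      also have "(\<Prod>i=Suc a..b. Mom key k ?K (level idx ?Z i)) = P"
        unfolding P_def
      proof (rule prod.cong[OF refl])
        fix i assume "i \<in> {Suc a..b}"
        then have i: "a < i" by simp
        \<comment> \<open>Since \<open>w\<close> lies in level \<open>a\<close>, later levels never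
          contain it and cannot notice that \<open>m\<close> is attached.\<close>
        have "Mom key k ?K (level idx X i) = Mom key k K (level idx X i)"
        proof (rule Mom_cong)
          fix B assume "B \<subseteq> level idx X i"
          then have "w \<notin> B" using wa i by (auto simp: level_def)
          then show "K (attach m w B) = K B" by (simp add: attach_def)
        qed simp
        then show "Mom key k ?K (level idx ?Z i) = Mom key k K (level idx X i)" using lev[OF i] by simp
      qed
      finally show ?thesis .
    qed
    have g1: "{y\<in>Y. key y < key w} = {y\<in>J. key y < key w}" if w: "w \<in> J" for w
    proof -
      have "idx y = a" if "y \<in> Y" "key y < key w" for y
        using monY[of y w] rngY[of y] that w by (auto simp: J_def level_def)
      then show ?thesis by (auto simp: J_def level_def)
    qed
    have t2: "Mom key k k {y\<in>Y. key y < key w} * Mom key k (\<lambda>B. K (attach m w B)) {y\<in>Y. key w \<le> key y} = 0"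
      if w: "w \<in> Y - J" for w
    proof -
      have wY: "w \<in> Y" and wX: "w \<in> X" using w YX by auto
      have wa: "a < idx w" using w rng[OF wX] by (auto simp: J_def level_def)
      \<comment> \<open>If the colours of \<open>m\<close> and \<open>w\<close> differ, joining them
        gives a mixed block and the tail vanishes. If they agree, the alternation of colours puts at
        least one full level between them, and the gap vanishes.\<close>
      show ?thesis
      proof (cases "col (idx w) = col a")
        case False
        have "Mom key k (\<lambda>B. K (attach m w B)) {y\<in>Y. key w \<le> key y} = 0"
        proof (rule Mom_min_vanish)
          fix B assume "w \<in> B"
          then show "K (attach m w B) = 0" using K[of w "attach m w B" m] False ma by (simp add: attach_def)
        qed (use finY wY in auto)
        then show ?thesis by simp
      next
        case True
        have "idx w \<noteq> Suc a" using alt[of a] True rng[OF wX] wa by auto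
        then have q: "Suc a < idx w" using wa by simp
        let ?G = "{y\<in>Y. key y < key w}"
        have lev: "level idx ?G i = level idx X i" if i: "a < i" "i < idx w" for i
        proof -
          have "key x < key w" if "x \<in> Y" "idx x = i" for x
          proof (rule ccontr)
            assume "\<not> key x < key w"
            moreover have "key x \<noteq> key w" using that i inj by (auto simp: inj_def)
            ultimately have "key w < key x" by simp
            then show False using monY[of w x] that i wY by auto
          qed
          then have "level idx ?G i = level idx Y i" by (auto simp: level_def)
          then show ?thesis using levY[of i] i by simp
        qed
        \<comment> \<open>The induction hypothesis is used with \<open>k\<close> as outer weight and
          right end \<open>idx w\<close>. Level \<open>idx w\<close>, cut off at \<open>w\<close>,
          is then an end level, while the levels strictly between \<open>a\<close> and
          \<open>idx w\<close> lie completely in the gap and are centred.\<close>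
        have "Mom key k k ?G = (\<Prod>i=a..idx w. Mom key k k (level idx ?G i))"
        proof (rule IH)
          have "card ?G \<le> card Y" using finY by (intro card_mono) auto
          then show "card ?G + (Suc (idx w) - a) < card X + (Suc b - a)" using cardY rng[OF wX] by linarith
          show "a \<le> idx x \<and> idx x \<le> idx w" if "x \<in> ?G" for x
            using that rngY[of x] monY[of x w] wY by auto
          show "Mom key k k (level idx ?G i) = 0" if "a < i" "i < idx w" for i
            using cen[of i] lev[OF that] that rng[OF wX] by simp
          show "col i \<noteq> col (Suc i)" if "a \<le> i" "i < idx w" for i using alt[of i] that rng[OF wX] by simp
        qed (use finY monY k in auto)
        moreover have "Mom key k k (level idx ?G (Suc a)) = 0"
          using cen[of "Suc a"] lev[of "Suc a"] q rng[OF wX] by simp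
        ultimately have "Mom key k k ?G = 0" using q by auto
        then show ?thesis by simp
      qed
    qed
    let ?T = "\<lambda>w. Mom key k k {y\<in>Y. key y < key w} * Mom key k (\<lambda>B. K (attach m w B)) {y\<in>Y. key w \<le> key y}"
    have "Mom key k K X = K {m} * Mom key k K Y + (\<Sum>w\<in>Y. ?T w)"
      unfolding XY by (rule Mom_rec[OF finY injY(1) mlt])
    also have "(\<Sum>w\<in>Y. ?T w) = (\<Sum>w\<in>J. ?T w)"
      by (rule sum.mono_neutral_right[OF finY JY]) (use t2 in simp)
    also have "\<dots> = (\<Sum>w\<in>J. Mom key k k {y\<in>J. key y < key w} * Mom key k (\<lambda>B. K (attach m w B)) {y\<in>J. key w \<le> key y}) * P"
      unfolding sum_distrib_right by (rule sum.cong) (simp_all add: t1 g1)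
    \<comment> \<open>Every surviving term carries the factor \<open>P\<close>; what remains is the
      same recursion read for the first interval \<open>insert m J\<close> alone.\<close>
    also have "K {m} * Mom key k K Y + \<dots> = Mom key k K (insert m J) * P"
      unfolding t0 using Mom_rec[OF finite_subset[OF JY finY] injY(2), of m k K] mlt JY by (simp add: algebra_simps subset_iff)
    finally show ?thesis using ab by (simp add: prod.atLeast_Suc_atMost P_def JX)
  qed
qed


section \<open>Maximal monochromatic intervals\<close>

definition ival :: "('x \<Rightarrow> 'k::linorder) \<Rightarrow> 'x set \<Rightarrow> 'x set \<Rightarrow> bool" where
  "ival key X J \<longleftrightarrow> J \<noteq> {} \<and> J \<subseteq> X \<and>
     (\<forall>i\<in>J. \<forall>k\<in>J. \<forall>j\<in>X. key i < key j \<and> key j < key k \<longrightarrow> j \<in> J)"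

definition mono_on_set :: "('x \<Rightarrow> 'i) \<Rightarrow> 'x set \<Rightarrow> bool" where
  "mono_on_set \<epsilon> J \<longleftrightarrow> (\<forall>i\<in>J. \<forall>j\<in>J. \<epsilon> i = \<epsilon> j)"

definition mmi :: "('x \<Rightarrow> 'k::linorder) \<Rightarrow> ('x \<Rightarrow> 'i) \<Rightarrow> 'x set \<Rightarrow> 'x set set" where
  "mmi key \<epsilon> X = {J. ival key X J \<and> mono_on_set \<epsilon> J \<and>
     \<not> (\<exists>J'. J \<subset> J' \<and> ival key X J' \<and> mono_on_set \<epsilon> J')}"

lemma mmi_subset: "J \<in> mmi key \<epsilon> X \<Longrightarrow> J \<subseteq> X \<and> J \<noteq> {}"
  by (simp add: mmi_def ival_def)

lemma max_mono_intervals_eq_mmi: "max_mono_intervals \<chi> \<epsilon> = mmi (ord_chi \<chi>) \<epsilon> {0..<length \<chi>}"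
  unfolding max_mono_intervals_def mmi_def chi_interval_def ival_def monochromatic_def mono_on_set_def prec_chi_def
  by (simp add: Ball_def)

lemma ival_image:
  assumes inj: "inj_on h X"
    and ord: "\<And>x y. x \<in> X \<Longrightarrow> y \<in> X \<Longrightarrow> key' (h x) < key' (h y) \<longleftrightarrow> key x < key y"
    and J: "J \<subseteq> X"
  shows "ival key' (h ` X) (h ` J) \<longleftrightarrow> ival key X J"
proof -
  have "h j \<in> h ` J \<longleftrightarrow> j \<in> J" if "j \<in> X" for j using inj_on_image_mem_iff[OF inj that J] .
  moreover have "h ` J \<subseteq> h ` X" using J by blast
  ultimately show ?thesis using J ord by (simp add: ival_def subset_iff)
qed

lemma mmi_image:
  assumes inj: "inj_on h X"
    and ord: "\<And>x y. x \<in> X \<Longrightarrow> y \<in> X \<Longrightarrow> key' (h x) < key' (h y) \<longleftrightarrow> key x < key y"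
  shows "mmi key' \<epsilon> (h ` X) = (`) h ` mmi key (\<lambda>x. \<epsilon> (h x)) X"
proof -
  have iv: "ival key' (h ` X) (h ` J) \<longleftrightarrow> ival key X J" if "J \<subseteq> X" for J
    by (rule ival_image[where key'=key' and key=key, OF inj ord that])
  have mo: "mono_on_set \<epsilon> (h ` J) \<longleftrightarrow> mono_on_set (\<lambda>x. \<epsilon> (h x)) J" for J by (simp add: mono_on_set_def)
  have sub: "h ` J \<subset> h ` J' \<longleftrightarrow> J \<subset> J'" if "J \<subseteq> X" "J' \<subseteq> X" for J J'
  proof -
    have "h ` J \<subseteq> h ` J' \<longleftrightarrow> J \<subseteq> J'"
      using inj_on_image_mem_iff[OF inj _ that(2)] that(1) unfolding image_subset_iff by (meson subset_iff)
    then show ?thesis using inj_on_image_eq_iff[OF inj that] by (auto simp: psubset_eq)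
  qed
  have P: "h ` J \<in> mmi key' \<epsilon> (h ` X) \<longleftrightarrow> J \<in> mmi key (\<lambda>x. \<epsilon> (h x)) X" if J: "J \<subseteq> X" for J
  proof -
    have "(\<exists>J'. h ` J \<subset> J' \<and> ival key' (h ` X) J' \<and> mono_on_set \<epsilon> J') \<longleftrightarrow>
          (\<exists>J'\<subseteq>X. h ` J \<subset> h ` J' \<and> ival key' (h ` X) (h ` J') \<and> mono_on_set \<epsilon> (h ` J'))"
      by (metis ival_def subset_image_iff)
    also have "\<dots> \<longleftrightarrow> (\<exists>J'. J \<subset> J' \<and> ival key X J' \<and> mono_on_set (\<lambda>x. \<epsilon> (h x)) J')"
      using iv mo sub[OF J] by (metis ival_def)
    finally show ?thesis unfolding mmi_def mem_Collect_eq iv[OF J] mo[of J] by (rule arg_cong)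
  qed
  show ?thesis
  proof (intro equalityI subsetI)
    fix J assume J: "J \<in> mmi key' \<epsilon> (h ` X)"
    then obtain J' where "J' \<subseteq> X" "J = h ` J'" using mmi_subset subset_imageE by metis
    then show "J \<in> (`) h ` mmi key (\<lambda>x. \<epsilon> (h x)) X" using P J by blast
  next
    fix J assume "J \<in> (`) h ` mmi key (\<lambda>x. \<epsilon> (h x)) X"
    then obtain J' where "J' \<in> mmi key (\<lambda>x. \<epsilon> (h x)) X" "J = h ` J'" by blast
    then show "J \<in> mmi key' \<epsilon> (h ` X)" using P mmi_subset by blast
  qed
qed

text \<open>\<open>idx\<close> numbers the maximal monochromatic intervals from left to right and
  \<open>col\<close> lists their colours. Distinct colours of neighbours express maximality;
  surjectivity onto \<open>{0..b}\<close> excludes empty intervals. The numbering supplies the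
  levels that the factorisation works with.\<close>

definition leveled :: "('x \<Rightarrow> 'k::linorder) \<Rightarrow> ('x \<Rightarrow> 'i) \<Rightarrow> 'x set \<Rightarrow> ('x \<Rightarrow> nat) \<Rightarrow> (nat \<Rightarrow> 'i) \<Rightarrow> nat \<Rightarrow> bool" where
  "leveled key \<epsilon> X idx col b \<longleftrightarrow> idx ` X = {0..b} \<and> (\<forall>x\<in>X. \<epsilon> x = col (idx x)) \<and>
     (\<forall>i<b. col i \<noteq> col (Suc i)) \<and> (\<forall>x\<in>X. \<forall>y\<in>X. key x < key y \<longrightarrow> idx x \<le> idx y)"

text \<open>Points are added in increasing order of the key. The new last point either continues the
  last level, if its colour is \<open>col b\<close>, or opens level \<open>Suc b\<close>.\<close>

lemma leveled_exists:
  fixes key :: "'x \<Rightarrow> 'k::linorder"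
  assumes "finite X" "X \<noteq> {}" "inj key"
  shows "\<exists>idx col b. leveled key \<epsilon> X idx col b"
  using assms(1,2)
proof (induction X rule: finite_ranking_induct[where f=key])
  case empty
  then show ?case by simp
next
  case (insert x S)
  show ?case
  \<comment> \<open>The ranking induction may present a point that already belongs to
    \<open>S\<close>; then nothing changes.\<close>
  proof (cases "S = {} \<or> x \<in> S")
    case True
    then consider "S = {}" | "x \<in> S" by blast
    then show ?thesis
    proof cases
      case 1
      then have "leveled key \<epsilon> (insert x S) (\<lambda>_. 0) (\<lambda>_. \<epsilon> x) 0" by (auto simp: leveled_def)
      then show ?thesis by blast
    next
      case 2
      then have "insert x S = S" "S \<noteq> {}" by auto
      then show ?thesis using insert.IH by simp
    qed
  next
    case False
    then obtain idx col b where l: "leveled key \<epsilon> S idx col b" using insert.IH by blast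
    have xS: "x \<notin> S" using False by simp
    have lt: "\<not> key x < key y" if "y \<in> S" for y using insert.hyps that by force
    have le: "idx y \<le> b" if "y \<in> S" for y
    proof -
      have "idx y \<in> {0..b}" using l that unfolding leveled_def by blast
      then show ?thesis by simp
    qed
    have img: "idx ` S = {0..b}" using l by (simp add: leveled_def)
    show ?thesis
    proof (cases "\<epsilon> x = col b")
      case True
      have "(idx(x := b)) ` insert x S = {0..b}"
      proof -
        have "(idx(x := b)) ` S = idx ` S" using xS by (intro image_cong) auto
        then show ?thesis using img by auto
      qed
      then have "leveled key \<epsilon> (insert x S) (idx(x := b)) col b"
        using l xS lt le True unfolding leveled_def by auto
      then show ?thesis by blast
    next
      case False
      have "(idx(x := Suc b)) ` insert x S = {0..Suc b}"
      proof -
        have "(idx(x := Suc b)) ` S = idx ` S" using xS by (intro image_cong) auto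
        then have "(idx(x := Suc b)) ` insert x S = insert (Suc b) {0..b}" using img by (simp only: image_insert) simp
        then show ?thesis by (simp add: atLeastAtMostSuc_conv)
      qed
      moreover have "\<forall>i<Suc b. (col(Suc b := \<epsilon> x)) i \<noteq> (col(Suc b := \<epsilon> x)) (Suc i)"
        using l False by (auto simp: leveled_def less_Suc_eq)
      moreover have "\<forall>y\<in>insert x S. \<epsilon> y = (col(Suc b := \<epsilon> x)) ((idx(x := Suc b)) y)"
        using l le xS by (force simp: leveled_def)
      moreover have "(idx(x := Suc b)) u \<le> (idx(x := Suc b)) v"
        if "u \<in> insert x S" "v \<in> insert x S" "key u < key v" for u v
        using l lt le[of u] that by (auto simp: leveled_def)
      ultimately have "leveled key \<epsilon> (insert x S) (idx(x := Suc b)) (col(Suc b := \<epsilon> x)) (Suc b)"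
        unfolding leveled_def by blast
      then show ?thesis by blast
    qed
  qed
qed

text \<open>Each level is a monochromatic interval. Conversely, an interval with points in levels
  \<open>i < j\<close> also contains a point of level \<open>Suc i\<close>, where the colour has
  changed; so a monochromatic interval stays within one level, and the levels are exactly the
  maximal ones.\<close>

lemma leveled_mmi:
  fixes key :: "'x \<Rightarrow> 'k::linorder"
  assumes inj: "inj key" and l: "leveled key \<epsilon> X idx col b"
  shows "mmi key \<epsilon> X = level idx X ` {0..b}" "inj_on (level idx X) {0..b}"
proof -
  have img: "idx ` X = {0..b}" and eps: "\<And>x. x \<in> X \<Longrightarrow> \<epsilon> x = col (idx x)"
    and alt: "\<And>i. i < b \<Longrightarrow> col i \<noteq> col (Suc i)"
    and mon: "\<And>x y. x \<in> X \<Longrightarrow> y \<in> X \<Longrightarrow> key x < key y \<Longrightarrow> idx x \<le> idx y"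
    using l by (auto simp: leveled_def)
  have ne: "\<exists>x\<in>X. idx x = i" if "i \<le> b" for i
  proof -
    have "i \<in> idx ` X" using img that by simp
    then show ?thesis by auto
  qed
  have le: "idx x \<le> b" if "x \<in> X" for x using img that by (metis atLeastAtMost_iff image_eqI)
  have key_lt: "key x < key y" if "x \<in> X" "y \<in> X" "idx x < idx y" for x y
  proof (rule ccontr)
    assume "\<not> key x < key y"
    moreover have "key x \<noteq> key y" using inj that by (auto simp: inj_def)
    ultimately have "idx y \<le> idx x" using mon that by force
    then show False using that by simp
  qed
  show inj_l: "inj_on (level idx X) {0..b}"
  proof (rule inj_onI)
    fix i j assume ij: "i \<in> {0..b}" "j \<in> {0..b}" "level idx X i = level idx X j"
    then obtain x where "x \<in> X" "idx x = i" using ne[of i] by auto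
    then have "x \<in> level idx X j" using ij(3) by (auto simp: level_def)
    then show "i = j" using \<open>idx x = i\<close> by (simp add: level_def)
  qed
  have lev: "ival key X (level idx X i)" "mono_on_set \<epsilon> (level idx X i)" if "i \<le> b" for i
  proof -
    show "ival key X (level idx X i)"
      unfolding ival_def
    proof (intro conjI ballI impI)
      show "level idx X i \<noteq> {}" "level idx X i \<subseteq> X" using ne[OF that] by (auto simp: level_def)
      fix u v w assume "u \<in> level idx X i" "v \<in> level idx X i" "w \<in> X" "key u < key w \<and> key w < key v"
      then have "idx u = i" "idx v = i" "idx u \<le> idx w" "idx w \<le> idx v"
        using mon[of u w] mon[of w v] by (auto simp: level_def)
      then show "w \<in> level idx X i" using \<open>w \<in> X\<close> by (simp add: level_def)
    qed
    show "mono_on_set \<epsilon> (level idx X i)" unfolding mono_on_set_def level_def using eps by simp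
  qed
  have sub: "\<exists>i\<le>b. J \<subseteq> level idx X i" if J: "ival key X J" "mono_on_set \<epsilon> J" for J
  proof -
    have JX: "J \<subseteq> X" using J by (simp add: ival_def)
    have no: False if xy: "x \<in> J" "y \<in> J" "idx x < idx y" for x y
    proof -
      have X: "x \<in> X" "y \<in> X" using xy JX by auto
      have b: "Suc (idx x) \<le> b" using xy(3) le[OF X(2)] by simp
      obtain z where z: "z \<in> J" "idx z = Suc (idx x)"
      proof (cases "Suc (idx x) = idx y")
        case True
        then show ?thesis using that[of y] xy by simp
      next
        case False
        obtain z where z: "z \<in> X" "idx z = Suc (idx x)" using ne[OF b] by blast
        then have "key x < key z" "key z < key y" using key_lt X xy False by auto
        then have "z \<in> J" using J(1) xy z unfolding ival_def by blast
        then show ?thesis using that z by blast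
      qed
      then have "\<epsilon> z = col (Suc (idx x))" "\<epsilon> x = col (idx x)" using eps JX X by auto
      moreover have "\<epsilon> z = \<epsilon> x" using J(2) z xy unfolding mono_on_set_def by blast
      ultimately show False using alt[of "idx x"] b by simp
    qed
    obtain x where x: "x \<in> J" using J(1) by (auto simp: ival_def)
    have "J \<subseteq> level idx X (idx x)"
    proof
      fix y assume y: "y \<in> J"
      then have "idx y = idx x" using no[of x y] no[of y x] x by force
      then show "y \<in> level idx X (idx x)" using y JX by (auto simp: level_def)
    qed
    then show ?thesis using le x JX by blast
  qed
  show "mmi key \<epsilon> X = level idx X ` {0..b}"
  proof (intro equalityI subsetI)
    fix J assume J: "J \<in> mmi key \<epsilon> X"
    then have "ival key X J" "mono_on_set \<epsilon> J" by (simp_all add: mmi_def)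
    then obtain i where i: "i \<le> b" "J \<subseteq> level idx X i" using sub by blast
    have "J = level idx X i"
    proof (rule ccontr)
      assume "J \<noteq> level idx X i"
      then have "J \<subset> level idx X i" using i by blast
      then show False using J lev[OF i(1)] unfolding mmi_def by blast
    qed
    then show "J \<in> level idx X ` {0..b}" using i by simp
  next
    fix J assume "J \<in> level idx X ` {0..b}"
    then obtain i where i: "i \<le> b" "J = level idx X i" by auto
    have "\<not> (\<exists>J'. J \<subset> J' \<and> ival key X J' \<and> mono_on_set \<epsilon> J')"
    proof (rule notI, elim exE conjE)
      fix J' assume J': "J \<subset> J'" "ival key X J'" "mono_on_set \<epsilon> J'"
      then obtain i' where i': "i' \<le> b" "J' \<subseteq> level idx X i'" using sub by blast
      obtain x where "x \<in> X" "idx x = i" using ne[OF i(1)] by blast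
      then have "x \<in> J" using i by (simp add: level_def)
      then have "x \<in> level idx X i'" using i' J' by blast
      then have "i = i'" using \<open>idx x = i\<close> by (simp add: level_def)
      then show False using J'(1) i' i by blast
    qed
    then show "J \<in> mmi key \<epsilon> X" unfolding mmi_def using lev[OF i(1)] i by simp
  qed
qed


section \<open>Cumulants of words indexed by finite sets\<close>

text \<open>An injective key inducing \<open>\<prec>\<^sub>\<chi>\<close> that, unlike \<open>ord_chi\<close>, does not depend on the length of
  the word and hence is inherited by subwords.\<close>

definition key_chi :: "(nat \<Rightarrow> face) \<Rightarrow> nat \<Rightarrow> real" where
  "key_chi c i = (if c i = Lf then - 1 / (real i + 1) else 1 / (real i + 1))"

lemma key_chi_less:
  "key_chi c i < key_chi c j \<longleftrightarrow>
     (if c i = Lf then (c j = Lf \<longrightarrow> i < j) else (c j \<noteq> Lf \<and> j < i))"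
proof -
  have pos: "1 / (real n + 1) > 0" for n by simp
  have "- (1 / (real i + 1)) < 1 / (real j + 1)" "\<not> 1 / (real i + 1) < - (1 / (real j + 1))"
    using pos[of i] pos[of j] by linarith+
  then show ?thesis by (simp add: key_chi_def field_simps)
qed

lemma inj_key_chi: "inj (key_chi c)"
proof (rule injI)
  fix i j assume "key_chi c i = key_chi c j"
  then show "i = j" using key_chi_less[of c i j] key_chi_less[of c j i] by (auto split: if_splits)
qed

definition word_prod :: "(nat \<Rightarrow> 'a::ring_1) \<Rightarrow> nat set \<Rightarrow> 'a" where
  "word_prod z B = prod_list (map z (sorted_list_of_set B))"

definition block_cumulant :: "(face list \<Rightarrow> 'a list \<Rightarrow> complex) \<Rightarrow> (nat \<Rightarrow> face) \<Rightarrow> (nat \<Rightarrow> 'a) \<Rightarrow> nat set \<Rightarrow> complex" where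
  "block_cumulant \<kappa> c z B = \<kappa> (map c (sorted_list_of_set B)) (map z (sorted_list_of_set B))"

text \<open>Required for every finite set of positions, so that it passes to subwords at once; the
  case \<open>B = {}\<close> says \<open>\<theta> 1 = 1\<close>. Taking \<open>K = \<kappa>\<close>
  expresses the bi-free relation for \<open>\<phi>\<close>, so one predicate covers both
  functionals.\<close>

definition moment_cumulant :: "('a::ring_1 \<Rightarrow> complex) \<Rightarrow> (face list \<Rightarrow> 'a list \<Rightarrow> complex) \<Rightarrow> (face list \<Rightarrow> 'a list \<Rightarrow> complex) \<Rightarrow> bool" where
  "moment_cumulant \<theta> \<kappa> K \<longleftrightarrow> (\<forall>c z B. finite B \<longrightarrow>
     \<theta> (word_prod z B) = Mom (key_chi c) (block_cumulant \<kappa> c z) (block_cumulant K c z) B)"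

lemma word_prod_cong:
  assumes "finite B" "\<And>i. i \<in> B \<Longrightarrow> z i = z' i" shows "word_prod z B = word_prod z' B"
  unfolding word_prod_def using assms by (metis map_eq_conv set_sorted_list_of_set)

lemma block_cumulant_cong:
  assumes "finite B" "\<And>i. i \<in> B \<Longrightarrow> z i = z' i" shows "block_cumulant \<kappa> c z B = block_cumulant \<kappa> c z' B"
  unfolding block_cumulant_def using assms by (metis map_eq_conv set_sorted_list_of_set)

section \<open>Adding scalars to letters\<close>

locale scaled_algebra =
  fixes sc :: "complex \<Rightarrow> 'a::ring_1 \<Rightarrow> 'a"
  assumes sc_add: "sc (s + t) x = sc s x + sc t x"
    and sc_mult_left: "sc t (x * y) = sc t x * y"
    and sc_mult_right: "sc t (x * y) = x * sc t y"
begin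

definition functional :: "('a \<Rightarrow> complex) \<Rightarrow> bool" where
  "functional \<phi> \<longleftrightarrow> (\<forall>x y. \<phi> (x + y) = \<phi> x + \<phi> y) \<and> (\<forall>t x. \<phi> (sc t x) = t * \<phi> x) \<and> \<phi> 1 = 1"

abbreviation shift :: "nat \<Rightarrow> complex \<Rightarrow> (nat \<Rightarrow> 'a) \<Rightarrow> nat \<Rightarrow> 'a" where
  "shift i t z \<equiv> z(i := z i + sc t 1)"

lemma word_prod_shift:
  assumes \<phi>: "functional \<phi>" and B: "finite B" "i \<in> B"
  shows "\<phi> (word_prod (shift i t z) B) = \<phi> (word_prod z B) + t * \<phi> (word_prod z (B - {i}))"
proof -
  obtain xs ys where L: "sorted_list_of_set B = xs @ i # ys"
    using B by (metis set_sorted_list_of_set split_list)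
  have d: "i \<notin> set xs" "i \<notin> set ys" using distinct_sorted_list_of_set[of B] unfolding L by auto
  have L': "sorted_list_of_set (B - {i}) = xs @ ys"
    using sorted_list_of_set_remove[OF B(1), of i] d unfolding L by (simp add: remove1_append)
  have m: "map (shift i t z) xs = map z xs" "map (shift i t z) ys = map z ys" using d by auto
  have "word_prod (shift i t z) B = word_prod z B + sc t (word_prod z (B - {i}))"
    unfolding word_prod_def L L' map_append list.map m
    by (simp add: algebra_simps sc_mult_right[symmetric] sc_mult_left[symmetric])
  then show ?thesis using \<phi> by (simp add: functional_def)
qed

text \<open>Both shifted families have the same moment on \<open>B\<close>, by
  \<open>word_prod_shift\<close> and \<open>Mom_shift\<close>, and they agree on smaller blocks by
  induction, so \<open>Mom_top\<close> identifies them on \<open>B\<close>. The disjunction on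
  \<open>\<kappa>\<close> admits two situations: its behaviour is already known, or it is the family
  under study and the induction hypothesis supplies it.\<close>

lemma block_cumulant_shift:
  assumes mc: "moment_cumulant \<theta> \<kappa> K" and \<theta>: "functional \<theta>"
    and \<kappa>: "(\<forall>B. finite B \<longrightarrow> i \<in> B \<longrightarrow> block_cumulant \<kappa> c (shift i t z) B =
        ((block_cumulant \<kappa> c z)({i} := block_cumulant \<kappa> c z {i} + t)) B) \<or> \<kappa> = K"
    and B: "finite B" "i \<in> B"
  shows "block_cumulant K c (shift i t z) B = ((block_cumulant K c z)({i} := block_cumulant K c z {i} + t)) B"
  using B
proof (induction B rule: finite_psubset_induct)
  case (psubset B)
  let ?k = "block_cumulant \<kappa> c z" and ?K = "block_cumulant K c z"
  let ?k1 = "?k({i} := ?k {i} + t)" and ?K1 = "?K({i} := ?K {i} + t)"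
  let ?k' = "block_cumulant \<kappa> c (shift i t z)" and ?K' = "block_cumulant K c (shift i t z)"
  have out: "block_cumulant \<kappa>' c (shift i t z) D = ((block_cumulant \<kappa>' c z)({i} := s)) D" if "finite D" "i \<notin> D" for \<kappa>' D s
  proof -
    have "block_cumulant \<kappa>' c (shift i t z) D = block_cumulant \<kappa>' c z D"
      by (rule block_cumulant_cong) (use that in auto)
    moreover have "D \<noteq> {i}" using that by auto
    ultimately show ?thesis by simp
  qed
  have K: "?K' D = ?K1 D" if D: "D \<subset> B" for D
    using psubset.IH[OF D] out[of D K] finite_subset[of D B] psubset.hyps D by blast
  have k: "?k' D = ?k1 D" if D: "D \<subset> B" for D
    using K[OF D] \<kappa> out[of D \<kappa>] finite_subset[of D B] psubset.hyps D by blast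
  have "Mom (key_chi c) ?k' ?K' B = \<theta> (word_prod (shift i t z) B)"
    using mc psubset.hyps by (simp add: moment_cumulant_def)
  also have "\<dots> = \<theta> (word_prod z B) + t * \<theta> (word_prod z (B - {i}))"
    by (rule word_prod_shift[OF \<theta> psubset.hyps psubset.prems])
  also have "\<dots> = Mom (key_chi c) ?k ?K B + t * Mom (key_chi c) ?k ?K (B - {i})"
    using mc psubset.hyps by (simp add: moment_cumulant_def)
  also have "\<dots> = Mom (key_chi c) ?k1 ?K1 B"
    by (rule Mom_shift[OF psubset.hyps psubset.prems, symmetric])
  finally have e1: "Mom (key_chi c) ?k' ?K' B = Mom (key_chi c) ?k1 ?K1 B" .
  have e2: "Mom (key_chi c) ?k' ?K' B - ?K' B = Mom (key_chi c) ?k1 ?K1 B - ?K1 B"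
    by (rule Mom_top) (use psubset.hyps psubset.prems k K in auto)
  show ?case using e2 unfolding e1 by (rule diff_left_imp_eq)
qed

text \<open>The value \<open>v\<close> is arbitrary because the induction needs it: with the shorter
  word normalised to \<open>1\<close>, the moment of the longer one is an affine function of the
  scalar at \<open>i\<close> with slope \<open>1\<close>, so any value can be hit. For a single
  letter the slope is \<open>\<phi> 1 = 1\<close>.\<close>

lemma shift_to_value:
  assumes \<phi>: "functional \<phi>" and J: "finite J" "J \<noteq> {}"
  shows "\<exists>s. \<phi> (word_prod (\<lambda>i. z i + sc (s i) 1) J) = v"
  using J
proof (induction J arbitrary: v rule: finite_ne_induct)
  case (singleton i)
  have "\<phi> (word_prod (\<lambda>i. z i + sc (v - \<phi> (z i)) 1) {i}) = v"
    using \<phi> by (simp add: word_prod_def functional_def)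
  then show ?case by (rule exI[where P="\<lambda>s. \<phi> (word_prod (\<lambda>i. z i + sc (s i) 1) {i}) = v"])
next
  case (insert i F)
  obtain s where s: "\<phi> (word_prod (\<lambda>i. z i + sc (s i) 1) F) = 1" using insert.IH by blast
  define z1 where "z1 = (\<lambda>i. z i + sc (s i) 1)"
  define t where "t = v - \<phi> (word_prod z1 (insert i F))"
  have "\<phi> (word_prod (shift i t z1) (insert i F)) = \<phi> (word_prod z1 (insert i F)) + t * \<phi> (word_prod z1 F)"
    using word_prod_shift[OF \<phi>, of "insert i F" i z1 t] insert.hyps by simp
  also have "\<dots> = v" using s by (simp add: t_def z1_def)
  also have "shift i t z1 = (\<lambda>j. z j + sc ((s(i := s i + t)) j) 1)" by (auto simp: z1_def sc_add add.assoc)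
  finally show ?case by blast
qed

end


section \<open>Cut weights and the two implications\<close>

definition cut :: "('x \<Rightarrow> 'i) \<Rightarrow> ('x set \<Rightarrow> complex) \<Rightarrow> 'x set \<Rightarrow> complex" where
  "cut \<epsilon> k B = (if mono_on_set \<epsilon> B then k B else 0)"

definition mixed_set :: "(face list \<Rightarrow> 'a list \<Rightarrow> complex) \<Rightarrow> ('i \<Rightarrow> face \<Rightarrow> 'a set) \<Rightarrow> bool" where
  "mixed_set \<kappa> A \<longleftrightarrow> (\<forall>c (\<epsilon>::nat \<Rightarrow> 'i) z B. finite B \<longrightarrow> (\<forall>i\<in>B. z i \<in> A (\<epsilon> i) (c i)) \<longrightarrow>
     \<not> mono_on_set \<epsilon> B \<longrightarrow> block_cumulant \<kappa> c z B = 0)"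

definition factor_set :: "('a::ring_1 \<Rightarrow> complex) \<Rightarrow> ('a \<Rightarrow> complex) \<Rightarrow> ('i \<Rightarrow> face \<Rightarrow> 'a set) \<Rightarrow> bool" where
  "factor_set \<theta> \<phi> A \<longleftrightarrow> (\<forall>c (\<epsilon>::nat \<Rightarrow> 'i) z B. finite B \<longrightarrow> B \<noteq> {} \<longrightarrow> (\<forall>i\<in>B. z i \<in> A (\<epsilon> i) (c i)) \<longrightarrow>
     (\<forall>J\<in>mmi (key_chi c) \<epsilon> B. \<phi> (word_prod z J) = 0) \<longrightarrow>
     \<theta> (word_prod z B) = (\<Prod>J\<in>mmi (key_chi c) \<epsilon> B. \<theta> (word_prod z J)))"

lemma Mom_cut_mono:
  assumes "mono_on_set \<epsilon> B"
  shows "Mom key (cut \<epsilon> k) (cut \<epsilon> K) B = Mom key k K B"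
proof (rule Mom_cong)
  fix D assume "D \<subseteq> B"
  then have "mono_on_set \<epsilon> D" using assms by (auto simp: mono_on_set_def)
  then show "cut \<epsilon> k D = k D" "cut \<epsilon> K D = K D" by (simp_all add: cut_def)
qed

text \<open>The cut weights vanish on mixed blocks by construction, so \<open>Mom_factor\<close>
  applies to any family; on a single interval the cut changes nothing, and the factors are true
  moments. Both implications rest on this identity.\<close>

lemma Mom_cut_factor:
  fixes \<epsilon> :: "nat \<Rightarrow> 'i"
  assumes mc\<phi>: "moment_cumulant \<phi> \<kappa> \<kappa>" and mc\<theta>: "moment_cumulant \<theta> \<kappa> K"
    and B: "finite B" "B \<noteq> {}"
    and centred: "\<And>J. J \<in> mmi (key_chi c) \<epsilon> B \<Longrightarrow> \<phi> (word_prod z J) = 0"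
  shows "Mom (key_chi c) (cut \<epsilon> (block_cumulant \<kappa> c z)) (cut \<epsilon> (block_cumulant K c z)) B =
    (\<Prod>J\<in>mmi (key_chi c) \<epsilon> B. \<theta> (word_prod z J))"
proof -
  let ?k = "block_cumulant \<kappa> c z" and ?K = "block_cumulant K c z" and ?key = "key_chi c"
  obtain idx col b where l: "leveled ?key \<epsilon> B idx col b" using leveled_exists[OF B inj_key_chi] by blast
  note mmi = leveled_mmi[OF inj_key_chi l]
  \<comment> \<open>\<open>\<epsilon>\<close> agrees with \<open>?e\<close> on \<open>B\<close>
    only, while \<open>Mom_factor\<close> asks for vanishing on every set with two colours of
    \<open>col\<close> composed with \<open>idx\<close>. The cut along \<open>?e\<close> has this
    property everywhere and coincides with the original cut on subsets of \<open>B\<close>.\<close>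
  let ?e = "\<lambda>x. col (idx x)"
  have eps: "mono_on_set ?e D \<longleftrightarrow> mono_on_set \<epsilon> D" if "D \<subseteq> B" for D
  proof -
    have "\<epsilon> x = ?e x" if "x \<in> D" for x using l that \<open>D \<subseteq> B\<close> by (auto simp: leveled_def)
    then show ?thesis by (simp add: mono_on_set_def)
  qed
  have cut_eq: "Mom ?key (cut \<epsilon> k) (cut \<epsilon> K) D = Mom ?key (cut ?e k) (cut ?e K) D" if "D \<subseteq> B" for k K D
    by (rule Mom_cong) (use eps that in \<open>auto simp: cut_def\<close>)
  have lev: "level idx B i \<subseteq> B" "finite (level idx B i)" "mono_on_set ?e (level idx B i)" for i
    using B by (auto simp: level_def mono_on_set_def)
  have levM: "Mom ?key (cut ?e k) (cut ?e K) (level idx B i) = Mom ?key k K (level idx B i)" for k K i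
    by (rule Mom_cut_mono[OF lev(3)])
  have rng: "0 \<le> idx x \<and> idx x \<le> b" if "x \<in> B" for x
  proof -
    have "idx x \<in> {0..b}" using l that unfolding leveled_def by blast
    then show ?thesis by simp
  qed
  have z: "cut ?e k D = 0" if "x \<in> D" "y \<in> D" "col (idx x) \<noteq> col (idx y)" for k :: "nat set \<Rightarrow> complex" and D x y
    using that unfolding cut_def mono_on_set_def by auto
  have "Mom ?key (cut \<epsilon> ?k) (cut \<epsilon> ?K) B = Mom ?key (cut ?e ?k) (cut ?e ?K) B" by (rule cut_eq) simp
  also have "\<dots> = (\<Prod>i=0..b. Mom ?key (cut ?e ?k) (cut ?e ?K) (level idx B i))"
  proof (rule Mom_factor[where col=col, OF inj_key_chi])
    show "Mom ?key (cut ?e ?k) (cut ?e ?k) (level idx B i) = 0" if "0 < i" "i < b" for i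
    proof -
      have "Mom ?key ?k ?k (level idx B i) = \<phi> (word_prod z (level idx B i))"
        using mc\<phi> lev(2) by (simp add: moment_cumulant_def)
      also have "\<dots> = 0" by (rule centred) (use mmi(1) that in auto)
      finally show ?thesis using levM by simp
    qed
  qed (use B rng z l in \<open>auto simp: leveled_def\<close>)
  also have "\<dots> = (\<Prod>i=0..b. \<theta> (word_prod z (level idx B i)))"
    by (rule prod.cong) (use mc\<theta> lev(2) levM in \<open>simp_all add: moment_cumulant_def\<close>)
  also have "\<dots> = (\<Prod>J\<in>mmi ?key \<epsilon> B. \<theta> (word_prod z J))"
    unfolding mmi(1) prod.reindex[OF mmi(2)] by simp
  finally show ?thesis .
qed

text \<open>Vanishing mixed cumulants make the cut invisible on subsets of \<open>B\<close>, so the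
  true moment is the cut sum.\<close>

lemma mixed_set_imp_factor_set:
  fixes A :: "'i \<Rightarrow> face \<Rightarrow> 'a::ring_1 set"
  assumes mc: "moment_cumulant \<phi> \<kappa> \<kappa>" "moment_cumulant \<theta> \<kappa> K"
    and mix: "mixed_set \<kappa> A" "mixed_set K A"
  shows "factor_set \<theta> \<phi> A"
  unfolding factor_set_def
proof (intro allI impI)
  fix c and \<epsilon> :: "nat \<Rightarrow> 'i" and z B
  assume B: "finite B" "B \<noteq> {}" and z: "\<forall>i\<in>B. z i \<in> A (\<epsilon> i) (c i)"
    and cen: "\<forall>J\<in>mmi (key_chi c) \<epsilon> B. \<phi> (word_prod z J) = 0"
  have zero: "block_cumulant \<kappa>' c z D = cut \<epsilon> (block_cumulant \<kappa>' c z) D" if "mixed_set \<kappa>' A" "D \<subseteq> B" for \<kappa>' D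
  proof (cases "mono_on_set \<epsilon> D")
    case False
    then have "block_cumulant \<kappa>' c z D = 0"
      using that z finite_subset[OF that(2) B(1)] unfolding mixed_set_def by (meson subsetD)
    then show ?thesis by (simp add: cut_def)
  qed (simp add: cut_def)
  have "\<theta> (word_prod z B) = Mom (key_chi c) (block_cumulant \<kappa> c z) (block_cumulant K c z) B"
    using mc B by (simp add: moment_cumulant_def)
  also have "\<dots> = Mom (key_chi c) (cut \<epsilon> (block_cumulant \<kappa> c z)) (cut \<epsilon> (block_cumulant K c z)) B"
    by (rule Mom_cong) (use zero mix in auto)
  also have "\<dots> = (\<Prod>J\<in>mmi (key_chi c) \<epsilon> B. \<theta> (word_prod z J))"
    by (rule Mom_cut_factor[OF mc B]) (use cen in blast)
  finally show "\<theta> (word_prod z B) = (\<Prod>J\<in>mmi (key_chi c) \<epsilon> B. \<theta> (word_prod z J))" .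
qed

context scaled_algebra
begin

lemma moment_cut_shift:
  assumes mc: "moment_cumulant \<phi> \<kappa> \<kappa>" "moment_cumulant \<theta> \<kappa> K" and fn: "functional \<phi>" "functional \<theta>"
    and B: "finite B" "i \<in> B"
    and sub: "\<theta> (word_prod z (B - {i})) = Mom (key_chi c) (cut \<epsilon> (block_cumulant \<kappa> c z)) (cut \<epsilon> (block_cumulant K c z)) (B - {i})"
  shows "\<theta> (word_prod (shift i t z) B) - Mom (key_chi c) (cut \<epsilon> (block_cumulant \<kappa> c (shift i t z))) (cut \<epsilon> (block_cumulant K c (shift i t z))) B
    = \<theta> (word_prod z B) - Mom (key_chi c) (cut \<epsilon> (block_cumulant \<kappa> c z)) (cut \<epsilon> (block_cumulant K c z)) B"
proof -
  have sh\<kappa>: "block_cumulant \<kappa> c (shift i t z) D = ((block_cumulant \<kappa> c z)({i} := block_cumulant \<kappa> c z {i} + t)) D"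
    if "finite D" "i \<in> D" for D
    by (rule block_cumulant_shift[OF mc(1) fn(1) disjI2[OF refl] that])
  have shK: "block_cumulant K c (shift i t z) D = ((block_cumulant K c z)({i} := block_cumulant K c z {i} + t)) D"
    if "finite D" "i \<in> D" for D
    by (rule block_cumulant_shift[OF mc(2) fn(2) disjI1 that]) (use sh\<kappa> in blast)
  \<comment> \<open>Singletons are monochromatic, so cutting keeps the shifted entry at
    \<open>{i}\<close>; all other entries are unchanged by the shift. Hence cutting and shifting
    commute.\<close>
  have mono1: "mono_on_set \<epsilon> {i}" by (simp add: mono_on_set_def)
  have *: "cut \<epsilon> (block_cumulant \<kappa>' c (shift i t z)) D = ((cut \<epsilon> (block_cumulant \<kappa>' c z))({i} := cut \<epsilon> (block_cumulant \<kappa>' c z) {i} + t)) D"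
    if sh: "\<And>D. finite D \<Longrightarrow> i \<in> D \<Longrightarrow> block_cumulant \<kappa>' c (shift i t z) D = ((block_cumulant \<kappa>' c z)({i} := block_cumulant \<kappa>' c z {i} + t)) D"
      and D: "D \<subseteq> B" for \<kappa>' D
  proof -
    have fD: "finite D" using D B finite_subset by blast
    show ?thesis
    proof (cases "i \<in> D")
      case True
      show ?thesis unfolding cut_def sh[OF fD True] using mono1 by simp
    next
      case False
      have "block_cumulant \<kappa>' c (shift i t z) D = block_cumulant \<kappa>' c z D"
        by (rule block_cumulant_cong[OF fD]) (use False in auto)
      moreover have "D \<noteq> {i}" using False by auto
      ultimately show ?thesis by (simp add: cut_def)
    qed
  qed
  have "Mom (key_chi c) (cut \<epsilon> (block_cumulant \<kappa> c (shift i t z))) (cut \<epsilon> (block_cumulant K c (shift i t z))) B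
    = Mom (key_chi c) ((cut \<epsilon> (block_cumulant \<kappa> c z))({i} := cut \<epsilon> (block_cumulant \<kappa> c z) {i} + t))
        ((cut \<epsilon> (block_cumulant K c z))({i} := cut \<epsilon> (block_cumulant K c z) {i} + t)) B"
    by (rule Mom_cong) (rule *, rule sh\<kappa> shK, assumption+)+
  also have "\<dots> = Mom (key_chi c) (cut \<epsilon> (block_cumulant \<kappa> c z)) (cut \<epsilon> (block_cumulant K c z)) B
     + t * Mom (key_chi c) (cut \<epsilon> (block_cumulant \<kappa> c z)) (cut \<epsilon> (block_cumulant K c z)) (B - {i})"
    by (rule Mom_shift[OF B])
  finally show ?thesis using word_prod_shift[OF fn(2) B, of z t] sub by (simp del: fun_upd_apply)
qed

lemma factor_set_imp_moment_cut:
  fixes A :: "'i \<Rightarrow> face \<Rightarrow> 'a set"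
  assumes mc: "moment_cumulant \<phi> \<kappa> \<kappa>" "moment_cumulant \<theta> \<kappa> K" and fn: "functional \<phi>" "functional \<theta>"
    and A: "\<And>\<iota> f x t. x \<in> A \<iota> f \<Longrightarrow> x + sc t 1 \<in> A \<iota> f"
    and V: "factor_set \<theta> \<phi> A"
    and B: "finite B" and z: "\<And>i. i \<in> B \<Longrightarrow> z i \<in> A (\<epsilon> i) (c i)"
  shows "\<theta> (word_prod z B) = Mom (key_chi c) (cut \<epsilon> (block_cumulant \<kappa> c z)) (cut \<epsilon> (block_cumulant K c z)) B"
  using B z
proof (induction B arbitrary: z rule: finite_psubset_induct)
  case (psubset B)
  define D where "D z = \<theta> (word_prod z B) - Mom (key_chi c) (cut \<epsilon> (block_cumulant \<kappa> c z)) (cut \<epsilon> (block_cumulant K c z)) B" for z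
  have shift: "D (shift i t z) = D z" if i: "i \<in> B" and z: "\<And>i. i \<in> B \<Longrightarrow> z i \<in> A (\<epsilon> i) (c i)" for i t z
    unfolding D_def
  proof (rule moment_cut_shift[OF mc fn psubset.hyps i])
    show "\<theta> (word_prod z (B - {i})) = Mom (key_chi c) (cut \<epsilon> (block_cumulant \<kappa> c z)) (cut \<epsilon> (block_cumulant K c z)) (B - {i})"
      by (rule psubset.IH) (use i z in auto)
  qed
  \<comment> \<open>The letters are shifted one at a time; adding a scalar keeps each intermediate
    word in its faces, as \<open>shift\<close> demands.\<close>
  have shifts: "D (\<lambda>i. if i \<in> S then z i + sc (s i) 1 else z i) = D z" if "finite S" "S \<subseteq> B" for S s
    using that
  proof (induction S rule: finite_induct)
    case empty
    show ?case by simp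
  next
    case (insert i S)
    let ?z = "\<lambda>i. if i \<in> S then z i + sc (s i) 1 else z i"
    have "(\<lambda>j. if j \<in> insert i S then z j + sc (s j) 1 else z j) = shift i (s i) ?z"
      using insert.hyps by auto
    moreover have "D (shift i (s i) ?z) = D ?z"
      by (rule shift) (use insert.prems psubset.prems A in auto)
    ultimately show ?case using insert by simp
  qed
  show ?case
  proof (cases "B = {}")
    case True
    then show ?thesis using fn by (simp add: word_prod_def functional_def)
  next
    case False
    obtain idx col b where l: "leveled (key_chi c) \<epsilon> B idx col b"
      using leveled_exists[OF psubset.hyps False inj_key_chi] by blast
    have "\<forall>J. \<exists>s. finite J \<and> J \<noteq> {} \<longrightarrow> \<phi> (word_prod (\<lambda>i. z i + sc (s i) 1) J) = 0"
      using shift_to_value[OF fn(1)] by blast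
    then obtain S where S: "\<And>J. finite J \<Longrightarrow> J \<noteq> {} \<Longrightarrow> \<phi> (word_prod (\<lambda>i. z i + sc (S J i) 1) J) = 0"
      by metis
    \<comment> \<open>Each letter receives the scalar chosen for its own level. The levels are
      disjoint, so centring one interval does not disturb another.\<close>
    define z' where "z' = (\<lambda>i. if i \<in> B then z i + sc (S (level idx B (idx i)) i) 1 else z i)"
    have cen: "\<phi> (word_prod z' J) = 0" if J: "J \<in> mmi (key_chi c) \<epsilon> B" for J
    proof -
      have JB: "J \<subseteq> B" "J \<noteq> {}" using mmi_subset[OF J] by auto
      then have fJ: "finite J" using psubset.hyps finite_subset by blast
      obtain j where j: "J = level idx B j" using J leveled_mmi(1)[OF inj_key_chi l] by blast
      have "word_prod z' J = word_prod (\<lambda>i. z i + sc (S J i) 1) J"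
        by (rule word_prod_cong[OF fJ]) (use j in \<open>auto simp: z'_def level_def\<close>)
      then show ?thesis using S[OF fJ JB(2)] by simp
    qed
    have z': "\<forall>i\<in>B. z' i \<in> A (\<epsilon> i) (c i)" using psubset.prems A by (simp add: z'_def)
    have "\<theta> (word_prod z' B) = (\<Prod>J\<in>mmi (key_chi c) \<epsilon> B. \<theta> (word_prod z' J))"
      using V psubset.hyps False z' cen unfolding factor_set_def by blast
    also have "\<dots> = Mom (key_chi c) (cut \<epsilon> (block_cumulant \<kappa> c z')) (cut \<epsilon> (block_cumulant K c z')) B"
      using Mom_cut_factor[where \<epsilon>=\<epsilon>, OF mc psubset.hyps False cen] by simp
    finally have "D z' = 0" by (simp add: D_def)
    moreover have "D z' = D z" unfolding z'_def by (rule shifts) (use psubset.hyps in auto)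
    ultimately show ?thesis by (simp add: D_def)
  qed
qed

text \<open>The true and the cut families have equal moments on \<open>B\<close> and agree on proper
  subsets by induction; \<open>Mom_top\<close> transfers this to \<open>B\<close> itself, which for
  mixed \<open>B\<close> means that the cumulant is zero. The alternative for
  \<open>\<kappa>\<close> covers bi-free cumulants (\<open>\<kappa> = K\<close>) and conditional
  ones, where the vanishing of mixed \<open>\<kappa>\<close> is established beforehand.\<close>

lemma factor_set_imp_mixed_set:
  fixes A :: "'i \<Rightarrow> face \<Rightarrow> 'a set"
  assumes mc: "moment_cumulant \<phi> \<kappa> \<kappa>" "moment_cumulant \<theta> \<kappa> K" and fn: "functional \<phi>" "functional \<theta>"
    and A: "\<And>\<iota> f x t. x \<in> A \<iota> f \<Longrightarrow> x + sc t 1 \<in> A \<iota> f"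
    and V: "factor_set \<theta> \<phi> A" and \<kappa>: "mixed_set \<kappa> A \<or> \<kappa> = K"
  shows "mixed_set K A"
proof -
  have "block_cumulant K c z B = cut \<epsilon> (block_cumulant K c z) B"
    if "finite B" "\<forall>i\<in>B. z i \<in> A (\<epsilon> i) (c i)" for c \<epsilon> z B
    using that
  proof (induction B rule: finite_psubset_induct)
    case (psubset B)
    let ?k = "block_cumulant \<kappa> c z" and ?K = "block_cumulant K c z"
    have K: "?K D = cut \<epsilon> ?K D" if "D \<subset> B" for D using psubset that by blast
    have k: "?k D = cut \<epsilon> ?k D" if D: "D \<subset> B" for D
    proof (cases "\<kappa> = K \<or> mono_on_set \<epsilon> D")
      case True
      then show ?thesis using K[OF D] by (auto simp: cut_def)
    next
      case False
      have "finite D" "\<forall>i\<in>D. z i \<in> A (\<epsilon> i) (c i)" using psubset D finite_subset[of D B] by blast+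
      then have "?k D = 0" using \<kappa> False unfolding mixed_set_def by blast
      then show ?thesis using False by (simp add: cut_def)
    qed
    show ?case
    proof (cases "B = {}")
      case True
      then show ?thesis by (simp add: cut_def mono_on_set_def)
    next
      case False
      have "Mom (key_chi c) ?k ?K B = \<theta> (word_prod z B)" using mc psubset.hyps by (simp add: moment_cumulant_def)
      also have "\<dots> = Mom (key_chi c) (cut \<epsilon> ?k) (cut \<epsilon> ?K) B"
        by (rule factor_set_imp_moment_cut[OF mc fn A V psubset.hyps]) (use psubset.prems in auto)
      finally have e1: "Mom (key_chi c) ?k ?K B = Mom (key_chi c) (cut \<epsilon> ?k) (cut \<epsilon> ?K) B" .
      have e2: "Mom (key_chi c) ?k ?K B - ?K B = Mom (key_chi c) (cut \<epsilon> ?k) (cut \<epsilon> ?K) B - cut \<epsilon> ?K B"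
        by (rule Mom_top[OF psubset.hyps False k K])
      show ?thesis using e2 unfolding e1 by (rule diff_left_imp_eq)
    qed
  qed
  then show ?thesis unfolding mixed_set_def cut_def by metis
qed

end


section \<open>Transfer between lists and finite sets\<close>

lemma nths_map_upt:
  assumes "V \<subseteq> {0..<n}"
  shows "nths (map f [0..<n]) V = map f (sorted_list_of_set V)"
proof -
  have "nths [0..<n] V = sorted_list_of_set V"
  proof (rule sorted_distinct_set_unique)
    have "finite V" using assms finite_subset by blast
    moreover have "set (nths [0..<n] V) = V" using assms by (force simp: set_nths)
    ultimately show "set (nths [0..<n] V) = set (sorted_list_of_set V)" by simp
  qed (auto simp: sorted_nths distinct_nthsI)
  then show ?thesis by (simp add: nths_map)
qed

lemma sorted_list_of_set_image:
  fixes h :: "nat \<Rightarrow> nat"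
  assumes h: "strict_mono_on {0..<n} h" and V: "V \<subseteq> {0..<n}"
  shows "sorted_list_of_set (h ` V) = map h (sorted_list_of_set V)"
proof (rule sorted_distinct_set_unique[symmetric])
  have fin: "finite V" using V finite_subset by blast
  have set: "set (sorted_list_of_set V) \<subseteq> {0..<n}" using V fin by simp
  have "sorted_wrt (\<lambda>i j. h i < h j) (sorted_list_of_set V)"
    by (rule sorted_wrt_mono_rel[OF _ strict_sorted_list_of_set[of V]])
       (use h set in \<open>auto simp: strict_mono_on_def\<close>)
  then have "sorted_wrt (<) (map h (sorted_list_of_set V))" by (simp add: sorted_wrt_map)
  then show "sorted (map h (sorted_list_of_set V))" "distinct (map h (sorted_list_of_set V))"
    by (simp_all add: strict_sorted_iff)
  show "set (map h (sorted_list_of_set V)) = set (sorted_list_of_set (h ` V))" using fin by simp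
qed auto

lemma nths_enum:
  fixes h :: "nat \<Rightarrow> nat"
  assumes h: "strict_mono_on {0..<n} h" and V: "V \<subseteq> {0..<n}"
  shows "nths (map (\<lambda>i. f (h i)) [0..<n]) V = map f (sorted_list_of_set (h ` V))"
  by (simp add: nths_map_upt[OF V] sorted_list_of_set_image[OF assms] o_def)

lemma enumerate_set:
  fixes B :: "nat set"
  assumes "finite B"
  obtains h :: "nat \<Rightarrow> nat" where "strict_mono_on {0..<card B} h" "h ` {0..<card B} = B"
proof
  let ?L = "sorted_list_of_set B"
  show "strict_mono_on {0..<card B} ((!) ?L)"
    using strict_sorted_list_of_set[of B] by (auto simp: strict_mono_on_def sorted_wrt_iff_nth_less)
  have "(!) ?L ` {0..<length ?L} = set ?L" by (auto simp: in_set_conv_nth)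
  then show "(!) ?L ` {0..<card B} = B" using assms by simp
qed

text \<open>On left positions \<open>ord_chi\<close> counts the earlier left ones and thus
  increases; on right positions it counts the later right ones and thus decreases, with the number
  of all left positions added so that every right value exceeds every left one. This is the order of
  \<open>key_chi\<close>.\<close>

lemma ord_chi_less:
  assumes i: "i < length \<chi>" and j: "j < length \<chi>"
  shows "ord_chi \<chi> i < ord_chi \<chi> j \<longleftrightarrow> key_chi ((!) \<chi>) i < key_chi ((!) \<chi>) j"
proof -
  define l where "l i = card {j. j < i \<and> \<chi> ! j = Lf}" for i
  define r where "r i = card {j. i < j \<and> j < length \<chi> \<and> \<chi> ! j = Rf}" for i
  have lmono: "l x < l y" if "x < y" "\<chi> ! x = Lf" for x y
    unfolding l_def by (rule psubset_card_mono) (use that in auto)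
  have rmono: "r y < r x" if "x < y" "y < length \<chi>" "\<chi> ! y = Rf" for x y
    unfolding r_def by (rule psubset_card_mono) (use that in auto)
  have o: "ord_chi \<chi> x = (if \<chi> ! x = Lf then l x else l (length \<chi>) + r x)" for x
    by (simp add: ord_chi_def l_def r_def)
  show ?thesis
    unfolding key_chi_less o
    using lmono[of i j] lmono[of j i] rmono[of i j] rmono[of j i] lmono[of i "length \<chi>"] lmono[of j "length \<chi>"] i j
    by (cases "\<chi> ! i"; cases "\<chi> ! j"; cases i j rule: linorder_cases) auto
qed

text \<open>Supplies the order hypothesis of the transport lemmas \<open>Mom_image\<close> and
  \<open>mmi_image\<close> for the increasing enumeration \<open>h\<close> of a finite set of
  positions.\<close>

lemma ord_chi_enum:
  fixes h :: "nat \<Rightarrow> nat"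
  assumes h: "strict_mono_on {0..<n} h" and ij: "i \<in> {0..<n}" "j \<in> {0..<n}"
  shows "key_chi c (h i) < key_chi c (h j) \<longleftrightarrow> ord_chi (map (\<lambda>i. c (h i)) [0..<n]) i < ord_chi (map (\<lambda>i. c (h i)) [0..<n]) j"
proof -
  have "h i < h j \<longleftrightarrow> i < j" "h j < h i \<longleftrightarrow> j < i"
    using strict_mono_on_less[OF h] ij by blast+
  then show ?thesis using ij by (subst ord_chi_less) (auto simp: key_chi_less)
qed

lemma max_mono_intervals_enum:
  fixes h :: "nat \<Rightarrow> nat"
  assumes h: "strict_mono_on {0..<n} h"
  shows "mmi (key_chi c) \<epsilon> (h ` {0..<n}) =
    (`) h ` max_mono_intervals (map (\<lambda>i. c (h i)) [0..<n]) (\<lambda>i. \<epsilon> (h i))"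
  using mmi_image[where key'="key_chi c", OF strict_mono_on_imp_inj_on[OF h] ord_chi_enum[OF h]]
  by (simp add: max_mono_intervals_eq_mmi)

lemma max_mono_intervals_subset:
  "J \<in> max_mono_intervals \<chi> \<epsilon> \<Longrightarrow> J \<subseteq> {0..<length \<chi>}"
  by (simp add: max_mono_intervals_def chi_interval_def)

lemma inj_on_image_max_mono_intervals:
  fixes h :: "nat \<Rightarrow> nat"
  assumes h: "strict_mono_on {0..<n} h" and n: "length \<chi> = n"
  shows "inj_on ((`) h) (max_mono_intervals \<chi> \<epsilon>)"
  by (rule inj_on_subset[OF inj_on_image_Pow[OF strict_mono_on_imp_inj_on[OF h]]])
     (use max_mono_intervals_subset n in blast)

text \<open>The shape in which the theorem states its condition, with the two functionals
  independent: the conjunction there is the instance with \<open>\<phi>\<close> in both places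
  together with the instance for \<open>\<theta>\<close>.\<close>

definition factor_list :: "('a::ring_1 \<Rightarrow> complex) \<Rightarrow> ('a \<Rightarrow> complex) \<Rightarrow> ('i \<Rightarrow> face \<Rightarrow> 'a set) \<Rightarrow> bool" where
  "factor_list \<theta> \<phi> A \<longleftrightarrow> (\<forall>\<chi> (\<epsilon>::nat \<Rightarrow> 'i) zs.
       length zs = length \<chi> \<and> \<chi> \<noteq> [] \<and>
       (\<forall>i<length \<chi>. zs ! i \<in> A (\<epsilon> i) (\<chi> ! i)) \<and>
       (\<forall>J\<in>max_mono_intervals \<chi> \<epsilon>. \<phi> (prod_list (nths zs J)) = 0) \<longrightarrow>
       \<theta> (prod_list zs) = (\<Prod>J\<in>max_mono_intervals \<chi> \<epsilon>. \<theta> (prod_list (nths zs J))))"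

lemma max_mono_intervals_word:
  fixes h :: "nat \<Rightarrow> nat"
  assumes h: "strict_mono_on {0..<n} h"
  shows "(\<forall>J\<in>mmi (key_chi c) \<epsilon> (h ` {0..<n}). \<phi> (word_prod z J) = 0) \<longleftrightarrow>
     (\<forall>J\<in>max_mono_intervals (map (\<lambda>i. c (h i)) [0..<n]) (\<lambda>i. \<epsilon> (h i)). \<phi> (prod_list (nths (map (\<lambda>i. z (h i)) [0..<n]) J)) = 0)"
    "(\<Prod>J\<in>mmi (key_chi c) \<epsilon> (h ` {0..<n}). \<theta> (word_prod z J)) =
     (\<Prod>J\<in>max_mono_intervals (map (\<lambda>i. c (h i)) [0..<n]) (\<lambda>i. \<epsilon> (h i)). \<theta> (prod_list (nths (map (\<lambda>i. z (h i)) [0..<n]) J)))"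
    "word_prod z (h ` {0..<n}) = prod_list (map (\<lambda>i. z (h i)) [0..<n])"
proof -
  let ?M = "max_mono_intervals (map (\<lambda>i. c (h i)) [0..<n]) (\<lambda>i. \<epsilon> (h i))"
  have e: "word_prod z (h ` J) = prod_list (nths (map (\<lambda>i. z (h i)) [0..<n]) J)" if "J \<in> ?M" for J
  proof -
    have "J \<subseteq> {0..<n}" using max_mono_intervals_subset[OF that] by simp
    then show ?thesis by (simp add: nths_enum[OF h] word_prod_def)
  qed
  show "(\<forall>J\<in>mmi (key_chi c) \<epsilon> (h ` {0..<n}). \<phi> (word_prod z J) = 0) \<longleftrightarrow>
     (\<forall>J\<in>?M. \<phi> (prod_list (nths (map (\<lambda>i. z (h i)) [0..<n]) J)) = 0)"
    unfolding max_mono_intervals_enum[OF h] using e by simp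
  have inj: "inj_on ((`) h) ?M" by (rule inj_on_image_max_mono_intervals[OF h]) simp
  show "(\<Prod>J\<in>mmi (key_chi c) \<epsilon> (h ` {0..<n}). \<theta> (word_prod z J)) =
     (\<Prod>J\<in>?M. \<theta> (prod_list (nths (map (\<lambda>i. z (h i)) [0..<n]) J)))"
    unfolding max_mono_intervals_enum[OF h] prod.reindex[OF inj] by (rule prod.cong) (simp_all add: e)
  show "word_prod z (h ` {0..<n}) = prod_list (map (\<lambda>i. z (h i)) [0..<n])"
    by (simp add: word_prod_def sorted_list_of_set_image[OF h] o_def)
qed

lemma strict_mono_on_ident: "strict_mono_on S (\<lambda>i::nat. i)"
  by (simp add: strict_mono_on_def)

text \<open>A list is the set \<open>{0..<n}\<close> with the identity as enumeration; conversely a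
  finite set becomes a list along its increasing enumeration \<open>h\<close>, with colours read
  through \<open>h\<close>.\<close>

lemma factor_set_iff_list:
  fixes A :: "'i \<Rightarrow> face \<Rightarrow> 'a::ring_1 set"
  shows "factor_set \<theta> \<phi> A \<longleftrightarrow> factor_list \<theta> \<phi> A"
proof
  assume s: "factor_set \<theta> \<phi> A"
  show "factor_list \<theta> \<phi> A"
    unfolding factor_list_def
  proof (intro allI impI, elim conjE)
    fix \<chi> and \<epsilon> :: "nat \<Rightarrow> 'i" and zs
    assume len: "length zs = length \<chi>" "\<chi> \<noteq> []" and zA: "\<forall>i<length \<chi>. zs ! i \<in> A (\<epsilon> i) (\<chi> ! i)"
      and cen: "\<forall>J\<in>max_mono_intervals \<chi> \<epsilon>. \<phi> (prod_list (nths zs J)) = 0"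
    let ?n = "length \<chi>"
    have m: "map (\<lambda>i. \<chi> ! i) [0..<?n] = \<chi>" "map (\<lambda>i. zs ! i) [0..<?n] = zs"
      using map_nth[of \<chi>] map_nth[of zs] len by simp_all
    note w = max_mono_intervals_word(1,2)[OF strict_mono_on_ident, where c="(!) \<chi>" and z="(!) zs" and \<epsilon>=\<epsilon> and n="?n", unfolded m image_ident]
      max_mono_intervals_word(3)[OF strict_mono_on_ident, where z="(!) zs" and n="?n", unfolded m image_ident]
    show "\<theta> (prod_list zs) = (\<Prod>J\<in>max_mono_intervals \<chi> \<epsilon>. \<theta> (prod_list (nths zs J)))"
      using s[unfolded factor_set_def, rule_format, of "{0..<?n}" "(!) zs" \<epsilon> "(!) \<chi>"] len zA cen[folded w(1)]
      unfolding w(2,3) by simp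
  qed
next
  assume l: "factor_list \<theta> \<phi> A"
  show "factor_set \<theta> \<phi> A"
    unfolding factor_set_def
  proof (intro allI impI)
    fix c and \<epsilon> :: "nat \<Rightarrow> 'i" and z B
    assume B: "finite B" "B \<noteq> {}" and zA: "\<forall>i\<in>B. z i \<in> A (\<epsilon> i) (c i)"
      and cen: "\<forall>J\<in>mmi (key_chi c) \<epsilon> B. \<phi> (word_prod z J) = 0"
    obtain h where h: "strict_mono_on {0..<card B} h" "h ` {0..<card B} = B" using enumerate_set[OF B(1)] .
    note w = max_mono_intervals_word(1,2)[OF h(1), where c=c and z=z and \<epsilon>=\<epsilon>, unfolded h(2)]
      max_mono_intervals_word(3)[OF h(1), where z=z, unfolded h(2)]
    have hB: "h i \<in> B" if "i < card B" for i using h(2) that by auto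
    have "card B \<noteq> 0" using B by simp
    then show "\<theta> (word_prod z B) = (\<Prod>J\<in>mmi (key_chi c) \<epsilon> B. \<theta> (word_prod z J))"
      unfolding w using cen[unfolded w] zA hB
      by (intro l[unfolded factor_list_def, rule_format]) simp
  qed
qed

lemma mixed_set_iff:
  fixes A :: "'i \<Rightarrow> face \<Rightarrow> 'a::ring_1 set"
  shows "mixed_set \<kappa> A \<longleftrightarrow> mixed_vanish \<kappa> A"
proof
  assume s: "mixed_set \<kappa> A"
  show "mixed_vanish \<kappa> A"
    unfolding mixed_vanish_def
  proof (intro allI impI, elim conjE)
    fix \<chi> and \<epsilon> :: "nat \<Rightarrow> 'i" and zs
    assume len: "length zs = length \<chi>" "\<chi> \<noteq> []" and zA: "\<forall>i<length \<chi>. zs ! i \<in> A (\<epsilon> i) (\<chi> ! i)"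
      and mix: "\<exists>i<length \<chi>. \<exists>j<length \<chi>. \<epsilon> i \<noteq> \<epsilon> j"
    have "\<not> mono_on_set \<epsilon> {0..<length \<chi>}" using mix unfolding mono_on_set_def by (metis atLeastLessThan_iff zero_le)
    then have "block_cumulant \<kappa> ((!) \<chi>) ((!) zs) {0..<length \<chi>} = 0"
      using s[unfolded mixed_set_def, rule_format, of "{0..<length \<chi>}" "(!) zs" \<epsilon> "(!) \<chi>"] zA by simp
    moreover have "map ((!) zs) [0..<length \<chi>] = zs" using map_nth[of zs] len by simp
    ultimately show "\<kappa> \<chi> zs = 0" by (simp add: block_cumulant_def map_nth)
  qed
next
  assume l: "mixed_vanish \<kappa> A"
  show "mixed_set \<kappa> A"
    unfolding mixed_set_def
  proof (intro allI impI)
    fix c and \<epsilon> :: "nat \<Rightarrow> 'i" and z B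
    assume B: "finite B" and zA: "\<forall>i\<in>B. z i \<in> A (\<epsilon> i) (c i)" and mix: "\<not> mono_on_set \<epsilon> B"
    obtain h where h: "strict_mono_on {0..<card B} h" "h ` {0..<card B} = B" using enumerate_set[OF B(1)] .
    have hB: "h i \<in> B" if "i < card B" for i using h(2) that by auto
    have L: "sorted_list_of_set B = map h [0..<card B]"
      using sorted_list_of_set_image[OF h(1) subset_refl] h(2) by simp
    have "\<exists>i<card B. \<exists>j<card B. \<epsilon> (h i) \<noteq> \<epsilon> (h j)"
    proof -
      from mix obtain x y where xy: "x \<in> B" "y \<in> B" "\<epsilon> x \<noteq> \<epsilon> y" unfolding mono_on_set_def by blast
      have "x \<in> h ` {0..<card B}" "y \<in> h ` {0..<card B}" using h(2) xy by simp_all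
      then obtain i j where "i < card B" "j < card B" "x = h i" "y = h j" by auto
      then show ?thesis using xy(3) by blast
    qed
    then show "block_cumulant \<kappa> c z B = 0"
      using l[unfolded mixed_vanish_def, rule_format, of "map z (map h [0..<card B])" "map c (map h [0..<card B])" "\<lambda>i. \<epsilon> (h i)"]
        zA hB unfolding block_cumulant_def L by fastforce
  qed
qed


section \<open>Existence and uniqueness of cumulants\<close>

text \<open>The flag says whether inner blocks carry the family being determined (bi-free cumulants)
  or the given family \<open>k\<close> (conditional cumulants).\<close>

definition inner_family :: "bool \<Rightarrow> (face list \<Rightarrow> 'a list \<Rightarrow> complex) \<Rightarrow> (face list \<Rightarrow> 'a list \<Rightarrow> complex) \<Rightarrow> face list \<Rightarrow> 'a list \<Rightarrow> complex" where
  "inner_family flag k K = (if flag then K else k)"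

definition list_Mom :: "(face list \<Rightarrow> 'a list \<Rightarrow> complex) \<Rightarrow> (face list \<Rightarrow> 'a list \<Rightarrow> complex) \<Rightarrow> face list \<Rightarrow> 'a list \<Rightarrow> complex" where
  "list_Mom k K \<chi> zs = Mom (ord_chi \<chi>) (\<lambda>V. k (nths \<chi> V) (nths zs V)) (\<lambda>V. K (nths \<chi> V) (nths zs V)) {0..<length \<chi>}"

definition cumulant_system :: "('a::ring_1 \<Rightarrow> complex) \<Rightarrow> bool \<Rightarrow> (face list \<Rightarrow> 'a list \<Rightarrow> complex) \<Rightarrow> (face list \<Rightarrow> 'a list \<Rightarrow> complex) \<Rightarrow> bool" where
  "cumulant_system \<theta> flag k K \<longleftrightarrow>
     (\<forall>\<chi> zs. length zs = length \<chi> \<and> \<chi> \<noteq> [] \<longrightarrow> \<theta> (prod_list zs) = list_Mom (inner_family flag k K) K \<chi> zs) \<and>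
     (\<forall>\<chi> zs. length zs \<noteq> length \<chi> \<or> \<chi> = [] \<longrightarrow> K \<chi> zs = 0)"

lemma nths_full: "length zs = n \<Longrightarrow> nths zs {0..<n} = zs"
  by (rule nths_all) simp

text \<open>Proper subwords are shorter, so everything except the term of the full word is
  determined by shorter words. Through \<open>inner_family\<close> this covers both systems: with
  the flag set, the inner weight varies together with \<open>K\<close>.\<close>

lemma list_Mom_top:
  assumes len: "length zs = length \<chi>" "\<chi> \<noteq> []"
    and eq: "\<And>\<chi>' zs'. length \<chi>' < length \<chi> \<Longrightarrow> K \<chi>' zs' = K' \<chi>' zs'"
  shows "list_Mom (inner_family flag k K) K \<chi> zs - K \<chi> zs = list_Mom (inner_family flag k K') K' \<chi> zs - K' \<chi> zs"
proof -
  let ?X = "{0..<length \<chi>}"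
  have full: "nths \<chi> ?X = \<chi>" "nths zs ?X = zs" using len by (simp_all add: nths_full)
  have short: "length (nths \<chi> B) < length \<chi>" if "B \<subset> ?X" for B
  proof -
    have "card B < card ?X" by (rule psubset_card_mono) (use that in auto)
    moreover have "{i. i < length \<chi> \<and> i \<in> B} = B" using that by auto
    ultimately show ?thesis by (simp add: length_nths)
  qed
  have "list_Mom (inner_family flag k K) K \<chi> zs - K (nths \<chi> ?X) (nths zs ?X) = list_Mom (inner_family flag k K') K' \<chi> zs - K' (nths \<chi> ?X) (nths zs ?X)"
    unfolding list_Mom_def
    by (rule Mom_top[where X="?X" and K="\<lambda>V. K (nths \<chi> V) (nths zs V)" and K'="\<lambda>V. K' (nths \<chi> V) (nths zs V)"])
       (use len eq short in \<open>auto simp: inner_family_def\<close>)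
  then show ?thesis unfolding full .
qed

lemma cumulant_system_unique:
  assumes "cumulant_system \<theta> flag k K" "cumulant_system \<theta> flag k K'"
  shows "K = K'"
proof -
  have "K \<chi> zs = K' \<chi> zs" for \<chi> zs
  proof (induction "length \<chi>" arbitrary: \<chi> zs rule: less_induct)
    case less
    show ?case
    proof (cases "length zs = length \<chi> \<and> \<chi> \<noteq> []")
      case True
      then have "list_Mom (inner_family flag k K) K \<chi> zs = list_Mom (inner_family flag k K') K' \<chi> zs"
        using assms unfolding cumulant_system_def by metis
      then show ?thesis using list_Mom_top[of zs \<chi> K K' flag k] True less by simp
    next
      case False
      then show ?thesis using assms unfolding cumulant_system_def by metis
    qed
  qed
  then show ?thesis by blast
qed

lemma cumulant_system_exists:
  fixes \<theta> :: "'a::ring_1 \<Rightarrow> complex"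
  shows "\<exists>K. cumulant_system \<theta> flag k K"
proof -
  define R :: "((face list \<times> 'a list) \<times> (face list \<times> 'a list)) set" where "R = measure (\<lambda>p. length (fst p))"
  \<comment> \<open>\<open>F\<close> solves the moment equation for its top term. The subtracted
    difference mentions \<open>f\<close> at the word itself, but by \<open>list_Mom_top\<close> it
    depends on \<open>f\<close> at shorter words only, which makes the recursion on length
    admissible.\<close>
  define F where "F f p = (case p of (\<chi>, zs) \<Rightarrow> if length zs \<noteq> length \<chi> \<or> \<chi> = [] then 0
     else \<theta> (prod_list zs) - (list_Mom (inner_family flag k (curry f)) (curry f) \<chi> zs - curry f \<chi> zs))" for f :: "face list \<times> 'a list \<Rightarrow> complex" and p
  have adm: "adm_wf R F"
    unfolding adm_wf_def
  proof (intro allI impI)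
    fix f g :: "face list \<times> 'a list \<Rightarrow> complex" and p
    assume eq: "\<forall>q. (q, p) \<in> R \<longrightarrow> f q = g q"
    obtain \<chi> zs where p: "p = (\<chi>, zs)" by (cases p)
    show "F f p = F g p"
    proof (cases "length zs \<noteq> length \<chi> \<or> \<chi> = []")
      case True
      then show ?thesis by (auto simp: F_def p)
    next
      case False
      have "list_Mom (inner_family flag k (curry f)) (curry f) \<chi> zs - curry f \<chi> zs
        = list_Mom (inner_family flag k (curry g)) (curry g) \<chi> zs - curry g \<chi> zs"
        by (rule list_Mom_top) (use False eq in \<open>auto simp: R_def p\<close>)
      then show ?thesis unfolding F_def p by simp
    qed
  qed
  define f where "f = wfrec R F"
  have "f = F f" unfolding f_def by (rule wfrec_fixpoint[OF _ adm]) (simp add: R_def)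
  then have "f p = F f p" for p by (rule fun_cong)
  then have "curry f \<chi> zs = F f (\<chi>, zs)" for \<chi> zs unfolding curry_def .
  then have f: "curry f \<chi> zs = (if length zs \<noteq> length \<chi> \<or> \<chi> = [] then 0
     else \<theta> (prod_list zs) - (list_Mom (inner_family flag k (curry f)) (curry f) \<chi> zs - curry f \<chi> zs))" for \<chi> zs
    unfolding F_def prod.case .
  have "cumulant_system \<theta> flag k (curry f)"
    unfolding cumulant_system_def
  proof (intro conjI allI impI)
    fix \<chi> :: "face list" and zs :: "'a list"
    assume "length zs = length \<chi> \<and> \<chi> \<noteq> []"
    then show "\<theta> (prod_list zs) = list_Mom (inner_family flag k (curry f)) (curry f) \<chi> zs"
      using f[of \<chi> zs] by simp
  next
    fix \<chi> :: "face list" and zs :: "'a list"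
    assume "length zs \<noteq> length \<chi> \<or> \<chi> = []"
    then show "curry f \<chi> zs = 0" using f[of \<chi> zs] by simp
  qed
  then show ?thesis by blast
qed

lemma BNC_eq_nc: "BNC \<chi> = nc (ord_chi \<chi>) {0..<length \<chi>}"
  by (simp add: BNC_def nc_def noncrossing_def prec_chi_def)

lemma inner_block_eq: "inner_block \<chi> = inner (ord_chi \<chi>)"
  by (intro ext) (simp add: inner_block_def inner_def prec_chi_def)

text \<open>With the flag set, inner and outer blocks both carry \<open>\<kappa>\<close>, so the
  case distinction in \<open>weight\<close> collapses to the plain product.\<close>

lemma bf_cumulant_eqs_iff: "bf_cumulant_eqs \<phi> \<kappa> \<longleftrightarrow> cumulant_system \<phi> True k \<kappa>"
  unfolding bf_cumulant_eqs_def cumulant_system_def list_Mom_def Mom_def weight_def BNC_eq_nc inner_family_def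
  by simp

lemma cond_cumulant_eqs_iff: "cond_cumulant_eqs \<theta> \<phi> K \<longleftrightarrow> cumulant_system \<theta> False (bf_cumulants \<phi>) K"
proof -
  have "(\<Prod>V\<in>{V\<in>\<pi>. inner_block \<chi> \<pi> V}. f V) * (\<Prod>V\<in>{V\<in>\<pi>. \<not> inner_block \<chi> \<pi> V}. g V)
     = (\<Prod>V\<in>\<pi>. if inner (ord_chi \<chi>) \<pi> V then f V else g V)"
    if "\<pi> \<in> BNC \<chi>" for \<chi> \<pi> and f g :: "nat set \<Rightarrow> complex"
  proof -
    have "finite \<pi>" using that nc_finite unfolding BNC_eq_nc by blast
    then show ?thesis unfolding inner_block_eq by (simp add: prod.If_cases Int_def)
  qed
  then show ?thesis
    unfolding cond_cumulant_eqs_def cumulant_system_def list_Mom_def Mom_def weight_def inner_family_def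
    by (simp add: BNC_eq_nc cong: sum.cong)
qed

lemma bf_cumulants_system: "cumulant_system \<phi> True k (bf_cumulants \<phi>)"
proof -
  have "\<exists>!\<kappa>. bf_cumulant_eqs \<phi> \<kappa>"
    unfolding bf_cumulant_eqs_iff[of _ _ k] using cumulant_system_exists cumulant_system_unique by blast
  from theI'[OF this] show ?thesis unfolding bf_cumulants_def bf_cumulant_eqs_iff[of _ _ k] .
qed

lemma cond_cumulants_system: "cumulant_system \<theta> False (bf_cumulants \<phi>) (cond_cumulants \<theta> \<phi>)"
proof -
  have "\<exists>!K. cond_cumulant_eqs \<theta> \<phi> K"
    unfolding cond_cumulant_eqs_iff using cumulant_system_exists cumulant_system_unique by blast
  from theI'[OF this] show ?thesis unfolding cond_cumulants_def cond_cumulant_eqs_iff .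
qed

text \<open>The defining equations speak of non-empty lists; transport along the increasing
  enumeration yields the relation for every non-empty finite set, and \<open>\<theta> 1 = 1\<close>
  supplies the empty one.\<close>

lemma moment_cumulant_system:
  assumes sys: "cumulant_system \<theta> flag k K" and one: "\<theta> 1 = 1"
  shows "moment_cumulant \<theta> (inner_family flag k K) K"
  unfolding moment_cumulant_def
proof (intro allI impI)
  fix c and z :: "nat \<Rightarrow> 'a" and B :: "nat set"
  assume B: "finite B"
  show "\<theta> (word_prod z B) = Mom (key_chi c) (block_cumulant (inner_family flag k K) c z) (block_cumulant K c z) B"
  proof (cases "B = {}")
    case True
    then show ?thesis using one by (simp add: word_prod_def)
  next
    case False
    obtain h where h: "strict_mono_on {0..<card B} h" "h ` {0..<card B} = B" using enumerate_set[OF B] .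
    let ?n = "card B" and ?\<chi> = "map (\<lambda>i. c (h i)) [0..<card B]" and ?zs = "map (\<lambda>i. z (h i)) [0..<card B]"
    have "?n \<noteq> 0" using B False by simp
    then have "\<theta> (prod_list ?zs) = list_Mom (inner_family flag k K) K ?\<chi> ?zs"
      using sys unfolding cumulant_system_def by simp
    moreover have "word_prod z B = prod_list ?zs" using max_mono_intervals_word(3)[OF h(1), of z] h(2) by simp
    moreover have block: "block_cumulant k' c z (h ` V) = k' (nths ?\<chi> V) (nths ?zs V)" if "V \<subseteq> {0..<?n}" for k' V
      by (simp add: block_cumulant_def nths_enum[OF h(1) that])
    then have "list_Mom (inner_family flag k K) K ?\<chi> ?zs =
      Mom (ord_chi ?\<chi>) (\<lambda>V. block_cumulant (inner_family flag k K) c z (h ` V)) (\<lambda>V. block_cumulant K c z (h ` V)) {0..<?n}"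
      unfolding list_Mom_def by (simp add: block) (rule Mom_cong; simp add: block)
    moreover have "Mom (key_chi c) (block_cumulant (inner_family flag k K) c z) (block_cumulant K c z) (h ` {0..<?n}) =
      Mom (ord_chi ?\<chi>) (\<lambda>V. block_cumulant (inner_family flag k K) c z (h ` V)) (\<lambda>V. block_cumulant K c z (h ` V)) {0..<?n}"
      by (rule Mom_image[where key'="key_chi c", OF strict_mono_on_imp_inj_on[OF h(1)] ord_chi_enum[OF h(1)]])
    ultimately show ?thesis using h(2) by simp
  qed
qed

section \<open>Factorisation of one functional against itself, and the equivalence\<close>

lemma mmi_nonempty:
  fixes key :: "'x \<Rightarrow> 'k::linorder"
  assumes "finite X" "X \<noteq> {}" "inj key" shows "mmi key \<epsilon> X \<noteq> {}"
proof -
  obtain idx col b where "leveled key \<epsilon> X idx col b" using leveled_exists[OF assms] by blast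
  then have "mmi key \<epsilon> X = level idx X ` {0..b}" by (rule leveled_mmi(1)[OF assms(3)])
  then show ?thesis by simp
qed

lemma max_mono_intervals_nonempty:
  assumes "\<chi> \<noteq> []" shows "max_mono_intervals \<chi> \<epsilon> \<noteq> {}"
proof -
  have "mmi (key_chi ((!) \<chi>)) \<epsilon> {0..<length \<chi>} \<noteq> {}"
    by (rule mmi_nonempty) (use assms inj_key_chi in auto)
  then show ?thesis
    using max_mono_intervals_enum[OF strict_mono_on_ident, of "(!) \<chi>" \<epsilon> "length \<chi>"] by (auto simp: map_nth)
qed

lemma prod_max_mono_intervals_zero:
  fixes f :: "nat set \<Rightarrow> complex"
  assumes "\<chi> \<noteq> []" "\<forall>J\<in>max_mono_intervals \<chi> \<epsilon>. f J = 0"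
  shows "(\<Prod>J\<in>max_mono_intervals \<chi> \<epsilon>. f J) = 0"
proof (rule prod_zero)
  show "finite (max_mono_intervals \<chi> \<epsilon>)"
    by (rule finite_subset[of _ "Pow {0..<length \<chi>}"]) (use max_mono_intervals_subset in auto)
  show "\<exists>J\<in>max_mono_intervals \<chi> \<epsilon>. f J = 0" using max_mono_intervals_nonempty[OF assms(1)] assms(2) by blast
qed

text \<open>If every interval is centred, all factors of the product vanish, and there is at least
  one of them since the word is non-empty.\<close>

lemma factor_list_centred:
  fixes A :: "'i \<Rightarrow> face \<Rightarrow> 'a::ring_1 set"
  shows "factor_list \<phi> \<phi> A \<longleftrightarrow> (\<forall>\<chi> (\<epsilon>::nat \<Rightarrow> 'i) zs.
       length zs = length \<chi> \<and> \<chi> \<noteq> [] \<and>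
       (\<forall>i<length \<chi>. zs ! i \<in> A (\<epsilon> i) (\<chi> ! i)) \<and>
       (\<forall>J\<in>max_mono_intervals \<chi> \<epsilon>. \<phi> (prod_list (nths zs J)) = 0) \<longrightarrow> \<phi> (prod_list zs) = 0)"
  unfolding factor_list_def
proof (intro iff_allI imp_cong refl)
  fix \<chi> and \<epsilon> :: "nat \<Rightarrow> 'i" and zs :: "'a list"
  assume "length zs = length \<chi> \<and> \<chi> \<noteq> [] \<and> (\<forall>i<length \<chi>. zs ! i \<in> A (\<epsilon> i) (\<chi> ! i)) \<and>
    (\<forall>J\<in>max_mono_intervals \<chi> \<epsilon>. \<phi> (prod_list (nths zs J)) = 0)"
  then have "(\<Prod>J\<in>max_mono_intervals \<chi> \<epsilon>. \<phi> (prod_list (nths zs J))) = 0"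
    using prod_max_mono_intervals_zero[of \<chi> \<epsilon> "\<lambda>J. \<phi> (prod_list (nths zs J))"] by blast
  then show "\<phi> (prod_list zs) = (\<Prod>J\<in>max_mono_intervals \<chi> \<epsilon>. \<phi> (prod_list (nths zs J))) \<longleftrightarrow> \<phi> (prod_list zs) = 0"
    by (simp only:)
qed

theorem theorem8:
  fixes sc :: "complex \<Rightarrow> 'a::ring_1 \<Rightarrow> 'a" and st :: "'a \<Rightarrow> 'a"
    and \<phi> \<theta> :: "'a \<Rightarrow> complex" and A :: "'i \<Rightarrow> face \<Rightarrow> 'a set"
  assumes "star_algebra sc st"
    and "is_state sc st \<phi>"
    and "is_state sc st \<theta>"
    and "\<forall>\<iota> f. unital_subalgebra sc (A \<iota> f)"
  shows "cond_bi_free \<theta> \<phi> A \<longleftrightarrow>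
    (\<forall>\<chi> (\<epsilon>::nat \<Rightarrow> 'i) zs.
       length zs = length \<chi> \<and> \<chi> \<noteq> [] \<and>
       (\<forall>i<length \<chi>. zs ! i \<in> A (\<epsilon> i) (\<chi> ! i)) \<and>
       (\<forall>J\<in>max_mono_intervals \<chi> \<epsilon>. \<phi> (prod_list (nths zs J)) = 0) \<longrightarrow>
       \<phi> (prod_list zs) = 0 \<and>
       \<theta> (prod_list zs) = (\<Prod>J\<in>max_mono_intervals \<chi> \<epsilon>. \<theta> (prod_list (nths zs J))))"
    (is "_ \<longleftrightarrow> ?V")
proof -
  interpret scaled_algebra sc
  proof
    have "vector_space sc" and m: "\<And>c x y. sc c (x * y) = sc c x * y \<and> sc c (x * y) = x * sc c y"
      using assms(1) unfolding star_algebra_def by blast+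
    then show "sc (s + t) x = sc s x + sc t x" for s t x by (simp add: vector_space_def)
    show "sc t (x * y) = sc t x * y" "sc t (x * y) = x * sc t y" for t x y using m by blast+
  qed
  have fn: "functional \<phi>" "functional \<theta>" using assms(2,3) unfolding is_state_def functional_def by auto
  have A: "x + sc t 1 \<in> A \<iota> f" if "x \<in> A \<iota> f" for \<iota> f x t
    using assms(4) that unfolding unital_subalgebra_def by blast
  have one: "\<phi> 1 = 1" "\<theta> 1 = 1" using fn by (simp_all add: functional_def)
  let ?\<kappa> = "bf_cumulants \<phi>" and ?K = "cond_cumulants \<theta> \<phi>"
  have mc: "moment_cumulant \<phi> ?\<kappa> ?\<kappa>" "moment_cumulant \<theta> ?\<kappa> ?K"
    using moment_cumulant_system[OF bf_cumulants_system[of \<phi>] one(1)]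
      moment_cumulant_system[OF cond_cumulants_system[of \<theta> \<phi>] one(2)]
    by (simp_all add: inner_family_def)
  have "?V \<longleftrightarrow> factor_list \<phi> \<phi> A \<and> factor_list \<theta> \<phi> A"
    unfolding factor_list_centred unfolding factor_list_def by blast
  \<comment> \<open>The unconditional case: \<open>\<phi>\<close> takes both places, and its
    cumulants serve as inner and outer weight.\<close>
  moreover have "mixed_set ?\<kappa> A \<longleftrightarrow> factor_set \<phi> \<phi> A"
    using mixed_set_imp_factor_set[OF mc(1) mc(1), of A] factor_set_imp_mixed_set[OF mc(1) mc(1) fn(1) fn(1), of A] A by blast
  \<comment> \<open>Bi-freeness is available here and provides the vanishing of the mixed inner
    weights, in either direction.\<close>
  moreover have "mixed_set ?K A \<longleftrightarrow> factor_set \<theta> \<phi> A" if "mixed_set ?\<kappa> A"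
    using mixed_set_imp_factor_set[OF mc that] factor_set_imp_mixed_set[OF mc fn, of A] A that by blast
  ultimately show ?thesis
    unfolding cond_bi_free_def bi_free_def mixed_set_iff[symmetric] factor_set_iff_list[symmetric] by blast
qed

end
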